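(* Let $\Gamma$ be a finitely generated residually finite group with an infinite amenable normal subgroup, and let $(\Gamma_n)$ be a Farber chain in $\Gamma$. Then $\mathrm{RG}(\Gamma,(\Gamma_n))=0$.
   Context: A chain in a finitely generated group $\Gamma$ is a sequence $\Gamma=\Gamma_0\ge\Gamma_1\ge\Gamma_2\ge\dots$ of subgroups of finite index. The coset tree $T=T(\Gamma,(\Gamma_n))$ is the rooted tree whose vertices of level $n$ are the right cosets $\Gamma_n g$ ($g\in\Gamma$), with an edge from $\Gamma_n g$ to $\Gamma_{n+1}g$ for all $n\ge 0$, $g\in\Gamma$. Its boundary $\partial T$ is the set of infinite rays starting from the root. For a vertex $t=\Gamma_n g$ of level $n$, the shadow $\mathrm{Sh}(t)\subseteq\partial T$ is the set of rays passing through $t$; the shadows form a base of the topology of $\partial T$, and $\mu$ is the Borel probability measure on $\partial T$ with $\mu(\mathrm{Sh}(t))=1/|\Gamma:\Gamma_n|$. $\Gamma$ acts on $T$ by right multiplication on cosets, and hence on $\partial T$ by measure-preserving homeomorphisms. The chain is Farber if this action on $\partial T$ is essentially free, i.e. $\mu$-almost every point has trivial stabilizer in $\Gamma$. $d(G)$ is the minimal number of generators of a group $G$. The rank gradient is $\mathrm{RG}(\Gamma,(\Gamma_n))=\lim_{n\to\infty}\frac{d(\Gamma_n)-1}{|\Gamma:\Gamma_n|}$ (the sequence is non-increasing). *)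

theory Defs
  imports "HOL-Algebra.Algebra" "HOL-Probability.Probability"
begin

section \<open>Finitely generated, residually finite and amenable groups\<close>

definition finitely_generated :: "('a, 'b) monoid_scheme \<Rightarrow> bool" where
  "finitely_generated G \<longleftrightarrow> (\<exists>S. finite S \<and> S \<subseteq> carrier G \<and> generate G S = carrier G)"

text \<open>This is only meaningful when \<^term>\<open>G\<close> is finitely generated; a subgroup \<^term>\<open>K\<close> is passed as
  \<^term>\<open>G\<lparr>carrier := K\<rparr>\<close>.\<close>

definition min_generators :: "('a, 'b) monoid_scheme \<Rightarrow> nat" where
  "min_generators G =
     (LEAST k. \<exists>S. finite S \<and> card S = k \<and> S \<subseteq> carrier G \<and> generate G S = carrier G)"

definition finite_index :: "('a, 'b) monoid_scheme \<Rightarrow> 'a set \<Rightarrow> bool" where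
  "finite_index G K \<longleftrightarrow> finite (rcosets\<^bsub>G\<^esub> K)"

definition index :: "('a, 'b) monoid_scheme \<Rightarrow> 'a set \<Rightarrow> nat" where
  "index G K = card (rcosets\<^bsub>G\<^esub> K)"

definition residually_finite :: "('a, 'b) monoid_scheme \<Rightarrow> bool" where
  "residually_finite G \<longleftrightarrow>
     (\<forall>g\<in>carrier G. g \<noteq> \<one>\<^bsub>G\<^esub> \<longrightarrow> (\<exists>K. K \<lhd> G \<and> finite_index G K \<and> g \<notin> K))"

text \<open>Amenability of a discrete group: there is a left-invariant finitely additive probability
  measure defined on all subsets.\<close>

definition amenable :: "('a, 'b) monoid_scheme \<Rightarrow> bool" where
  "amenable G \<longleftrightarrow>
     (\<exists>m :: 'a set \<Rightarrow> real.
        m (carrier G) = 1 \<and>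
        (\<forall>A. A \<subseteq> carrier G \<longrightarrow> 0 \<le> m A) \<and>
        (\<forall>A B. A \<subseteq> carrier G \<longrightarrow> B \<subseteq> carrier G \<longrightarrow> A \<inter> B = {} \<longrightarrow> m (A \<union> B) = m A + m B) \<and>
        (\<forall>A. \<forall>g\<in>carrier G. A \<subseteq> carrier G \<longrightarrow> m (g <#\<^bsub>G\<^esub> A) = m A))"


section \<open>Chains, the coset tree and its boundary\<close>

locale subgroup_chain = group G for G (structure) +
  fixes H :: "nat \<Rightarrow> 'a set"
  assumes chain_0: "H 0 = carrier G"
    and chain_decreasing: "\<And>n. H (Suc n) \<subseteq> H n"
    and chain_subgroup: "\<And>n. subgroup (H n) G"
    and chain_finite_index: "\<And>n. finite_index G (H n)"

definition level_vertices :: "('a, 'b) monoid_scheme \<Rightarrow> (nat \<Rightarrow> 'a set) \<Rightarrow> nat \<Rightarrow> 'a set set" where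
  "level_vertices G H n = rcosets\<^bsub>G\<^esub> (H n)"

definition tree_edge ::
  "('a, 'b) monoid_scheme \<Rightarrow> (nat \<Rightarrow> 'a set) \<Rightarrow> nat \<Rightarrow> 'a set \<Rightarrow> 'a set \<Rightarrow> bool" where
  "tree_edge G H n u v \<longleftrightarrow>
     (\<exists>g\<in>carrier G. u = H n #>\<^bsub>G\<^esub> g \<and> v = H (Suc n) #>\<^bsub>G\<^esub> g)"

text \<open>A ray \<^term>\<open>r\<close> is encoded by listing its vertex \<^term>\<open>r n\<close> of each level \<^term>\<open>n\<close>, so equal cosets
  \<^term>\<open>H n\<close> and \<^term>\<open>H (Suc n)\<close> are still different vertices.\<close>

definition tree_boundary :: "('a, 'b) monoid_scheme \<Rightarrow> (nat \<Rightarrow> 'a set) \<Rightarrow> (nat \<Rightarrow> 'a set) set" where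
  "tree_boundary G H =
     {r. \<forall>n. r n \<in> level_vertices G H n \<and> tree_edge G H n (r n) (r (Suc n))}"

definition shadow ::
  "('a, 'b) monoid_scheme \<Rightarrow> (nat \<Rightarrow> 'a set) \<Rightarrow> nat \<Rightarrow> 'a set \<Rightarrow> (nat \<Rightarrow> 'a set) set" where
  "shadow G H n t = {r \<in> tree_boundary G H. r n = t}"

definition shadows :: "('a, 'b) monoid_scheme \<Rightarrow> (nat \<Rightarrow> 'a set) \<Rightarrow> (nat \<Rightarrow> 'a set) set set" where
  "shadows G H = {shadow G H n t | n t. t \<in> level_vertices G H n}"

definition boundary_topology ::
  "('a, 'b) monoid_scheme \<Rightarrow> (nat \<Rightarrow> 'a set) \<Rightarrow> (nat \<Rightarrow> 'a set) topology" where
  "boundary_topology G H = topology_generated_by (shadows G H)"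

definition is_boundary_measure ::
  "('a, 'b) monoid_scheme \<Rightarrow> (nat \<Rightarrow> 'a set) \<Rightarrow> (nat \<Rightarrow> 'a set) measure \<Rightarrow> bool" where
  "is_boundary_measure G H M \<longleftrightarrow>
     prob_space M \<and>
     space M = tree_boundary G H \<and>
     sets M = sigma_sets (tree_boundary G H) {U. openin (boundary_topology G H) U} \<and>
     (\<forall>n. \<forall>t\<in>level_vertices G H n. measure M (shadow G H n t) = 1 / real (index G (H n)))"

text \<open>Existence and uniqueness are established for every chain in
  \<open>ex1_boundary_measure\<close> below.\<close>

definition boundary_measure ::
  "('a, 'b) monoid_scheme \<Rightarrow> (nat \<Rightarrow> 'a set) \<Rightarrow> (nat \<Rightarrow> 'a set) measure" where
  "boundary_measure G H = (THE M. is_boundary_measure G H M)"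

definition ray_action :: "('a, 'b) monoid_scheme \<Rightarrow> (nat \<Rightarrow> 'a set) \<Rightarrow> 'a \<Rightarrow> (nat \<Rightarrow> 'a set)" where
  "ray_action G r g = (\<lambda>n. r n #>\<^bsub>G\<^esub> g)"

definition ray_stabilizer :: "('a, 'b) monoid_scheme \<Rightarrow> (nat \<Rightarrow> 'a set) \<Rightarrow> 'a set" where
  "ray_stabilizer G r = {g \<in> carrier G. ray_action G r g = r}"

definition farber_chain :: "('a, 'b) monoid_scheme \<Rightarrow> (nat \<Rightarrow> 'a set) \<Rightarrow> bool" where
  "farber_chain G H \<longleftrightarrow>
     subgroup_chain G H \<and> (AE r in boundary_measure G H. ray_stabilizer G r = {\<one>\<^bsub>G\<^esub>})"


section \<open>The rank gradient\<close>

definition rank_ratio :: "('a, 'b) monoid_scheme \<Rightarrow> (nat \<Rightarrow> 'a set) \<Rightarrow> nat \<Rightarrow> real" where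
  "rank_ratio G H n =
     (real (min_generators (G\<lparr>carrier := H n\<rparr>)) - 1) / real (index G (H n))"

definition rank_gradient :: "('a, 'b) monoid_scheme \<Rightarrow> (nat \<Rightarrow> 'a set) \<Rightarrow> real" where
  "rank_gradient G H = lim (rank_ratio G H)"


section \<open>Existence and uniqueness of the boundary measure\<close>

context subgroup_chain
begin

abbreviation "V \<equiv> level_vertices G H"
abbreviation "Sh \<equiv> shadow G H"
abbreviation "Bd \<equiv> tree_boundary G H"

lemma finite_V: "finite (V n)"
  using chain_finite_index[of n] by (simp add: level_vertices_def finite_index_def)

lemma V_subset: "t \<in> V n \<Longrightarrow> t \<subseteq> carrier G"
  using rcosets_part_G[OF chain_subgroup[of n]] by (auto simp: level_vertices_def)

lemma H_subset: "H n \<subseteq> carrier G"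
  using chain_subgroup subgroup.subset by blast

lemma V_iff: "t \<in> V n \<longleftrightarrow> (\<exists>g\<in>carrier G. t = H n #> g)"
  by (auto simp: level_vertices_def RCOSETS_def)

lemma V_nonempty: "t \<in> V n \<Longrightarrow> t \<noteq> {}"
  using rcos_self[OF _ chain_subgroup[of n]] by (auto simp: V_iff)

lemma V_eqI: "t \<in> V n \<Longrightarrow> s \<in> V n \<Longrightarrow> x \<in> t \<Longrightarrow> x \<in> s \<Longrightarrow> t = s"
  using rcos_disjoint[OF chain_subgroup[of n]]
  by (auto simp: level_vertices_def pairwise_def disjnt_def)

lemma V_mem: "t \<in> V n \<Longrightarrow> g \<in> t \<Longrightarrow> t = H n #> g"
  using V_iff repr_independence[OF _ _ chain_subgroup[of n]] by metis

lemma rcos_mono: "H (Suc n) #> g \<subseteq> H n #> g"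
  using chain_decreasing[of n] by (auto simp: r_coset_def)

lemma edge_iff: "tree_edge G H n u v \<longleftrightarrow> u \<in> V n \<and> v \<in> V (Suc n) \<and> v \<subseteq> u"
proof
  assume "tree_edge G H n u v"
  then show "u \<in> V n \<and> v \<in> V (Suc n) \<and> v \<subseteq> u"
    using rcos_mono by (auto simp: tree_edge_def V_iff)
next
  assume a: "u \<in> V n \<and> v \<in> V (Suc n) \<and> v \<subseteq> u"
  then obtain g where g: "g \<in> carrier G" "v = H (Suc n) #> g" by (auto simp: V_iff)
  have "g \<in> v" using rcos_self[OF g(1) chain_subgroup] g by simp
  then have "u = H n #> g" using a V_mem by blast
  then show "tree_edge G H n u v" using g by (auto simp: tree_edge_def)
qed

lemma Bd_iff: "r \<in> Bd \<longleftrightarrow> (\<forall>n. r n \<in> V n \<and> r (Suc n) \<subseteq> r n)"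
  by (auto simp: tree_boundary_def edge_iff)

lemma ray_antimono: "r \<in> Bd \<Longrightarrow> n \<le> m \<Longrightarrow> r m \<subseteq> r n"
  by (rule lift_Suc_antimono_le) (auto simp: Bd_iff)

lemma V_0: "V 0 = {carrier G}"
proof -
  have "carrier G #> g = carrier G" if "g \<in> carrier G" for g
    using coset_join2[OF that subgroup_self that] .
  moreover have "\<exists>g. g \<in> carrier G" using one_closed by blast
  ultimately show ?thesis by (auto simp: V_iff chain_0)
qed

lemma shadow_nested:
  assumes "r \<in> Sh n t" "r \<in> Sh m s" "n \<le> m"
  shows "Sh m s \<subseteq> Sh n t"
proof
  fix q assume q: "q \<in> Sh m s"
  have r: "r \<in> Bd" "r n = t" "r m = s" and q': "q \<in> Bd" "q m = s"
    using assms q by (auto simp: shadow_def)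
  have "s \<subseteq> t" "s \<subseteq> q n" using ray_antimono[OF _ assms(3)] r q' by blast+
  moreover have V: "s \<in> V m" "t \<in> V n" "q n \<in> V n" using r q' by (auto simp: Bd_iff)
  moreover have "s \<noteq> {}" using V(1) V_nonempty by blast
  ultimately have "q n = t" using V_eqI by blast
  then show "q \<in> Sh n t" using q' by (simp add: shadow_def)
qed

lemma shadows_Int:
  assumes "a \<in> shadows G H" "b \<in> shadows G H" "x \<in> a" "x \<in> b"
  shows "a \<inter> b \<in> shadows G H"
proof -
  obtain n t m s where *: "a = Sh n t" "t \<in> V n" "b = Sh m s" "s \<in> V m"
    using assms by (auto simp: shadows_def)
  have "a \<subseteq> b \<or> b \<subseteq> a"
    using shadow_nested[of x n t m s] shadow_nested[of x m s n t] assms(3,4) * nat_le_linear[of n m]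
    by metis
  then show ?thesis using assms(1,2) by (metis inf.absorb1 inf.absorb2)
qed

lemma countable_shadows: "countable (shadows G H)"
proof -
  have "shadows G H = (\<Union>n. Sh n ` V n)" by (auto simp: shadows_def)
  then show ?thesis using finite_V by (simp add: countable_finite)
qed

lemma shadows_Pow: "shadows G H \<subseteq> Pow Bd"
  by (auto simp: shadows_def shadow_def)

lemma shadow_root: "Sh 0 (carrier G) = Bd"
proof -
  have "r 0 = carrier G" if "r \<in> Bd" for r
    using that V_0 unfolding Bd_iff by blast
  then show ?thesis by (auto simp: shadow_def)
qed

lemma Bd_in_shadows: "Bd \<in> shadows G H"
  using shadow_root V_0 by (force simp: shadows_def)

lemma open_iff_base:
  "openin (boundary_topology G H) U \<longleftrightarrow> (\<exists>K \<subseteq> shadows G H. U = \<Union>K)"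
proof
  assume "openin (boundary_topology G H) U"
  then have "generate_topology_on (shadows G H) U"
    by (simp add: boundary_topology_def openin_topology_generated_by_iff)
  then have "\<forall>x\<in>U. \<exists>s\<in>shadows G H. x \<in> s \<and> s \<subseteq> U"
  proof induction
    case (Int a b)
    show ?case
    proof
      fix x assume "x \<in> a \<inter> b"
      then obtain s t where st: "s \<in> shadows G H" "x \<in> s" "s \<subseteq> a" "t \<in> shadows G H" "x \<in> t" "t \<subseteq> b"
        using Int.IH by blast
      show "\<exists>s\<in>shadows G H. x \<in> s \<and> s \<subseteq> a \<inter> b"
        by (rule bexI[of _ "s \<inter> t"]) (use st shadows_Int[of s t x] in auto)
    qed
  next
    case (UN K)
    show ?case
    proof
      fix x assume "x \<in> \<Union>K"
      then obtain k where k: "k \<in> K" "x \<in> k" by blast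
      then obtain s where "s \<in> shadows G H" "x \<in> s" "s \<subseteq> k" using UN.IH by blast
      then show "\<exists>s\<in>shadows G H. x \<in> s \<and> s \<subseteq> \<Union>K" using k by blast
    qed
  next
    case (Basis s)
    then show ?case by auto
  qed simp
  then have "U = \<Union>{s \<in> shadows G H. s \<subseteq> U}" by blast
  then show "\<exists>K \<subseteq> shadows G H. U = \<Union>K" by (intro exI[of _ "{s \<in> shadows G H. s \<subseteq> U}"]) auto
next
  assume "\<exists>K \<subseteq> shadows G H. U = \<Union>K"
  then show "openin (boundary_topology G H) U"
    unfolding boundary_topology_def using topology_generated_by_Basis
    by (metis openin_Union subsetD)
qed

lemma borel_eq_sigma_shadows:
  "sigma_sets Bd {U. openin (boundary_topology G H) U} = sigma_sets Bd (shadows G H)"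
proof (rule sigma_sets_eqI)
  fix U assume "U \<in> {U. openin (boundary_topology G H) U}"
  then obtain K where "K \<subseteq> shadows G H" "U = \<Union>K" by (auto simp: open_iff_base)
  then show "U \<in> sigma_sets Bd (shadows G H)"
    using countable_subset[OF _ countable_shadows]
    by (auto intro!: sigma_sets_UNION)
next
  fix U assume "U \<in> shadows G H"
  then show "U \<in> sigma_sets Bd {U. openin (boundary_topology G H) U}"
    by (auto simp: boundary_topology_def intro!: topology_generated_by_Basis)
qed

lemma boundary_measure_unique:
  assumes M: "is_boundary_measure G H M" and N: "is_boundary_measure G H N"
  shows "M = N"
proof (rule measure_eqI_generator_eq[where E = "insert {} (shadows G H)" and A = "\<lambda>_. Bd"])
  interpret M: prob_space M using M by (simp add: is_boundary_measure_def)
  interpret N: prob_space N using N by (simp add: is_boundary_measure_def)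
  show "Int_stable (insert {} (shadows G H))"
    using shadows_Int by (fastforce simp: Int_stable_def)
  show "insert {} (shadows G H) \<subseteq> Pow Bd" using shadows_Pow by auto
  have ins: "sigma_sets Bd (insert {} (shadows G H)) = sigma_sets Bd (shadows G H)"
    by (rule sigma_sets_eqI) (auto intro: sigma_sets.Empty)
  show "sets M = sigma_sets Bd (insert {} (shadows G H))"
    using M by (simp add: is_boundary_measure_def borel_eq_sigma_shadows ins)
  show "sets N = sigma_sets Bd (insert {} (shadows G H))"
    using N by (simp add: is_boundary_measure_def borel_eq_sigma_shadows ins)
  show "emeasure M B = emeasure N B" if "B \<in> insert {} (shadows G H)" for B
    using that M N
    by (auto simp: shadows_def is_boundary_measure_def M.emeasure_eq_measure N.emeasure_eq_measure)
  show "range (\<lambda>_. Bd) \<subseteq> insert {} (shadows G H)" using Bd_in_shadows by auto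
  show "emeasure M Bd \<noteq> \<infinity>" for i :: nat using M.emeasure_finite by simp
qed auto

definition children :: "nat \<Rightarrow> 'a set \<Rightarrow> 'a set set" where
  "children n u = {v \<in> V (Suc n). v \<subseteq> u}"

definition branching :: "nat \<Rightarrow> nat" where
  "branching n = card (children n (H n))"

lemma finite_children: "finite (children n u)"
  using finite_V by (simp add: children_def)

lemma V_translate: "t \<in> V n \<Longrightarrow> g \<in> carrier G \<Longrightarrow> t #> g \<in> V n"
  using coset_mult_assoc[OF H_subset] by (auto simp: V_iff)

lemma r_coset_mono: "u \<subseteq> v \<Longrightarrow> u #> g \<subseteq> v #> g"
  by (auto simp: r_coset_def)

lemma coset_cancel: "u \<subseteq> carrier G \<Longrightarrow> g \<in> carrier G \<Longrightarrow> u #> g #> inv g = u"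
  "u \<subseteq> carrier G \<Longrightarrow> g \<in> carrier G \<Longrightarrow> u #> inv g #> g = u"
  by (simp_all add: coset_mult_assoc)

lemma card_children:
  assumes "u \<in> V n" shows "card (children n u) = branching n"
proof -
  obtain g where g: "g \<in> carrier G" "u = H n #> g" using assms by (auto simp: V_iff)
  have "bij_betw (\<lambda>v. v #> g) (children n (H n)) (children n u)"
  proof (rule bij_betw_byWitness[where f' = "\<lambda>v. v #> inv g"])
    show "\<forall>v\<in>children n (H n). v #> g #> inv g = v" "\<forall>v\<in>children n u. v #> inv g #> g = v"
      using V_subset g coset_cancel by (auto simp: children_def)
    show "(\<lambda>v. v #> g) ` children n (H n) \<subseteq> children n u"
      using V_translate[OF _ g(1)] r_coset_mono[of _ "H n" g] g(2) unfolding children_def by blast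
    have "u #> inv g = H n" using g coset_cancel H_subset by simp
    then show "(\<lambda>v. v #> inv g) ` children n u \<subseteq> children n (H n)"
      using V_translate[OF _ inv_closed[OF g(1)]] r_coset_mono[of _ u "inv g"]
      unfolding children_def by blast
  qed
  then show ?thesis using bij_betw_same_card by (fastforce simp: branching_def)
qed

lemma parent: "t \<in> V (Suc n) \<Longrightarrow> \<exists>u\<in>V n. t \<in> children n u"
proof -
  assume "t \<in> V (Suc n)"
  then obtain g where g: "g \<in> carrier G" "t = H (Suc n) #> g" unfolding V_iff by blast
  then have "H n #> g \<in> V n" "t \<subseteq> H n #> g" using rcos_mono unfolding V_iff by blast+
  then show ?thesis using \<open>t \<in> V (Suc n)\<close> by (auto simp: children_def)
qed

lemma H_in_V: "H n \<in> V n"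
  using coset_join2[OF one_closed chain_subgroup subgroup.one_closed[OF chain_subgroup]]
  by (metis V_iff one_closed)

lemma branching_pos: "branching n > 0"
proof -
  have "H (Suc n) \<in> children n (H n)"
    using H_in_V chain_decreasing by (auto simp: children_def)
  then show ?thesis using finite_children by (auto simp: branching_def card_gt_0_iff)
qed

lemma card_V_Suc: "card (V (Suc n)) = card (V n) * branching n"
proof -
  have "V (Suc n) = (\<Union>u\<in>V n. children n u)" using parent by (auto simp: children_def)
  also have "card \<dots> = (\<Sum>u\<in>V n. card (children n u))"
  proof (rule card_UN_disjoint)
    have "u = v" if uv: "u \<in> V n" "v \<in> V n" "w \<in> children n u" "w \<in> children n v" for u v w
    proof -
      obtain x where "x \<in> w" using uv(3) V_nonempty[of w "Suc n"] by (auto simp: children_def)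
      then show ?thesis using uv V_eqI[of u n v x] by (auto simp: children_def)
    qed
    then show "\<forall>u\<in>V n. \<forall>v\<in>V n. u \<noteq> v \<longrightarrow> children n u \<inter> children n v = {}"
      by blast
  qed (use finite_V finite_children in auto)
  finally show ?thesis using card_children by simp
qed

lemma card_V: "card (V n) = (\<Prod>i<n. branching i)"
  by (induction n) (simp_all add: V_0 card_V_Suc)

text \<open>The measure is the image of a product of uniform measures under a map that reads a sequence
  of digits as successive choices of children.\<close>

definition child :: "nat \<Rightarrow> 'a set \<Rightarrow> nat \<Rightarrow> 'a set" where
  "child n u = (SOME f. bij_betw f {..<branching n} (children n u))"

lemma child_bij: "u \<in> V n \<Longrightarrow> bij_betw (child n u) {..<branching n} (children n u)"
proof -
  assume "u \<in> V n"
  then have "\<exists>f. bij_betw f {..<branching n} (children n u)"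
    using ex_bij_betw_nat_finite[OF finite_children[of n u]]
    by (simp add: card_children atLeast0LessThan)
  then show ?thesis unfolding child_def by (rule someI_ex)
qed

primrec digits_ray :: "(nat \<Rightarrow> nat) \<Rightarrow> nat \<Rightarrow> 'a set" where
  "digits_ray x 0 = carrier G"
| "digits_ray x (Suc n) = child n (digits_ray x n) (x n)"

lemma child_mem: "u \<in> V n \<Longrightarrow> i < branching n \<Longrightarrow> child n u i \<in> children n u"
  using child_bij[of u n] by (auto simp: bij_betw_def)

lemma digits_ray_V:
  assumes "\<And>i. x i < branching i" shows "digits_ray x n \<in> V n"
  by (induction n) (use V_0 child_mem assms in \<open>auto simp: children_def\<close>)

lemma digits_ray_Bd:
  assumes "\<And>i. x i < branching i" shows "digits_ray x \<in> Bd"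
  unfolding Bd_iff using digits_ray_V[of x] child_mem assms by (auto simp: children_def)

lemma digits_ray_cylinder:
  assumes "t \<in> V n"
  shows "\<exists>a. (\<forall>i<n. a i < branching i) \<and>
    (\<forall>x. (\<forall>i. x i < branching i) \<longrightarrow> digits_ray x n = t \<longleftrightarrow> (\<forall>i<n. x i = a i))"
  using assms
proof (induction n arbitrary: t)
  case 0
  then show ?case by (auto simp: V_0)
next
  case (Suc n)
  obtain u where u: "u \<in> V n" "t \<in> children n u" using parent Suc.prems by blast
  obtain a where "(\<forall>i<n. a i < branching i) \<and>
    (\<forall>x. (\<forall>i. x i < branching i) \<longrightarrow> digits_ray x n = u \<longleftrightarrow> (\<forall>i<n. x i = a i))"
    using Suc.IH[OF u(1)] by (rule exE)
  note a = conjunct1[OF this] conjunct2[OF this]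
  have "t \<in> child n u ` {..<branching n}"
    using u(2) bij_betw_imp_surj_on[OF child_bij[OF u(1)]] by simp
  then obtain j where j: "j < branching n" "child n u j = t" by blast
  have "digits_ray x (Suc n) = t \<longleftrightarrow> (\<forall>i<Suc n. x i = (a(n := j)) i)"
    if x: "\<forall>i. x i < branching i" for x
  proof -
    have "digits_ray x (Suc n) = t \<longleftrightarrow> digits_ray x n = u \<and> x n = j"
    proof
      assume *: "digits_ray x (Suc n) = t"
      have "t \<subseteq> digits_ray x n"
        using child_mem[OF digits_ray_V, of x "x n" n] x * by (auto simp: children_def)
      moreover have "t \<subseteq> u" "t \<noteq> {}" using u Suc.prems V_nonempty by (auto simp: children_def)
      ultimately have "digits_ray x n = u" using V_eqI[OF _ u(1)] digits_ray_V[of x n] x by blast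
      moreover from this have "x n = j"
        using inj_onD[OF bij_betw_imp_inj_on[OF child_bij[OF u(1)]], of "x n" j] * j x by simp
      ultimately show "digits_ray x n = u \<and> x n = j" by blast
    qed (use j in auto)
    then show ?thesis using a(2)[rule_format, OF x[rule_format]] by (auto simp: less_Suc_eq)
  qed
  moreover have "\<forall>i<Suc n. (a(n := j)) i < branching i" using a j by (auto simp: less_Suc_eq)
  ultimately show ?case by blast
qed

lemma boundary_measure_exists: "\<exists>M. is_boundary_measure G H M"
proof -
  define U where "U i = uniform_count_measure {..<branching i}" for i
  have U: "prob_space (U i)" for i
    unfolding U_def using branching_pos[of i] by (intro prob_space_uniform_count_measure) auto
  interpret product_prob_space U UNIV
    by (intro product_prob_space.intro product_sigma_finite.intro product_prob_space_axioms.intro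
        prob_space_imp_sigma_finite U)
  define P where "P = PiM UNIV U"
  have P: "x \<in> space P \<longleftrightarrow> (\<forall>i. x i < branching i)" for x
    by (auto simp: P_def space_PiM U_def space_uniform_count_measure PiE_iff)
  have cyl: "{x \<in> space P. digits_ray x n = t} \<in> sets P \<and>
      emeasure P {x \<in> space P. digits_ray x n = t} = ennreal (1 / real (index G (H n)))"
    if t: "t \<in> V n" for n t
  proof -
    obtain a where "(\<forall>i<n. a i < branching i) \<and>
      (\<forall>x. (\<forall>i. x i < branching i) \<longrightarrow> digits_ray x n = t \<longleftrightarrow> (\<forall>i<n. x i = a i))"
      using digits_ray_cylinder[OF t] by (rule exE)
    note a = conjunct1[OF this] conjunct2[OF this]
    have eq: "{x \<in> space P. digits_ray x n = t} = {x \<in> space P. \<forall>i\<in>{..<n}. x i \<in> {a i}}"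
      using a(2) by (auto simp: P)
    have 1: "{a i} \<in> sets (U i)" if "i \<in> {..<n}" for i
      using a(1) that by (simp add: U_def sets_uniform_count_measure)
    have "emeasure P {x \<in> space P. \<forall>i\<in>{..<n}. x i \<in> {a i}} = (\<Prod>i<n. emeasure (U i) {a i})"
      unfolding P_def by (rule emeasure_PiM_Collect) (use 1 in auto)
    also have "\<dots> = (\<Prod>i<n. ennreal (1 / real (branching i)))"
      using a(1) by (intro prod.cong) (auto simp: U_def emeasure_uniform_count_measure)
    also have "\<dots> = ennreal (1 / real (index G (H n)))"
      by (simp add: prod_ennreal prod_dividef card_V[symmetric] index_def level_vertices_def
          flip: of_nat_prod)
    finally have "emeasure P {x \<in> space P. digits_ray x n = t} = ennreal (1 / real (index G (H n)))"
      by (simp only: eq)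
    moreover have "{x \<in> space P. \<forall>i\<in>{..<n}. x i \<in> {a i}} \<in> sets P"
    proof (intro sets.sets_Collect_finite_All)
      fix i assume i: "i \<in> {..<n}"
      have "(\<lambda>x. x i) \<in> measurable P (U i)" unfolding P_def by measurable
      from measurable_sets[OF this 1[OF i]] show "{x \<in> space P. x i \<in> {a i}} \<in> sets P"
        by (simp add: vimage_def Int_def conj_commute)
    qed simp
    ultimately show ?thesis by (simp only: eq)
  qed
  define S where "S = sigma Bd (shadows G H)"
  have vim: "digits_ray -` Sh n t \<inter> space P = {x \<in> space P. digits_ray x n = t}" for n t
    using digits_ray_Bd by (auto simp: shadow_def P)
  have meas: "digits_ray \<in> measurable P S"
    unfolding S_def
    by (rule measurable_measure_of) (use shadows_Pow digits_ray_Bd cyl vim in \<open>auto simp: P shadows_def\<close>)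
  have setsS: "sets S = sigma_sets Bd (shadows G H)" "space S = Bd"
    unfolding S_def using shadows_Pow by simp_all
  have "is_boundary_measure G H (distr P S digits_ray)"
    unfolding is_boundary_measure_def
  proof (intro conjI allI ballI)
    show "prob_space (distr P S digits_ray)"
      using meas unfolding P_def by (rule P.prob_space_distr)
    fix n t assume t: "t \<in> V n"
    have "Sh n t \<in> sets S" unfolding setsS using t by (auto simp: shadows_def)
    then show "measure (distr P S digits_ray) (Sh n t) = 1 / real (index G (H n))"
      using meas cyl[OF t] by (simp add: measure_def emeasure_distr vim)
  qed (simp_all add: setsS borel_eq_sigma_shadows)
  then show ?thesis by blast
qed

theorem ex1_boundary_measure: "\<exists>!M. is_boundary_measure G H M"
  using boundary_measure_exists boundary_measure_unique by blast

corollary boundary_measure: "is_boundary_measure G H (boundary_measure G H)"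
  unfolding boundary_measure_def by (rule theI') (rule ex1_boundary_measure)

end

end

theory Submission
  imports Defs
begin

text \<open>Why the rank gradient vanishes. The group acts on the finite set of level-\<open>n\<close> cosets, and
  \<open>H n\<close> is the stabilizer of a point. If the groupoid of this transitive action is generated by
  \<open>e\<close> arrows, collapsing a spanning tree shows that \<open>H n\<close> is generated by \<open>e - [G : H n] + 1\<close> elements
  (\<open>stabilizer_generators\<close>). Hence it suffices to generate the groupoid by at most
  \<open>(1 + \<epsilon>) [G : H n]\<close> arrows for all large \<open>n\<close>; this is a finite version of the statement that the
  action on the boundary has cost one.

  Two ideas make generation that cheap. First, the arrows labelled by a finite subset \<open>K\<close> of the amenable
  normal subgroup \<open>N\<close> cost about one arrow per point. Almost all of the finite set is cut into tiles,
  which are pieces of translates of a Folner set; a star generates the arrows inside a tile, and the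
  few arrows that start at boundary points are added one by one (\<open>tiling_arrows\<close>). The tiles
  are split off greedily, each with few boundary points compared with its own size; averaging over base
  points shows that translates of one fixed Folner set allow this until nothing is left.

  Second, the generators \<open>s\<close> of \<open>G\<close> cost almost nothing. As \<open>N\<close> is infinite, there is
  a section of small density which every point reaches by an element \<open>l\<close> of a fixed finite subset of
  \<open>N\<close> (\<open>sparse_section\<close>). It is enough to add the arrows labelled \<open>s\<close> on this section, because
  \<open>s = l \<otimes> s \<otimes> (inv s \<otimes> inv l \<otimes> s)\<close> and the last factor lies in \<open>N\<close> by normality
  (\<open>cheap_generating_arrows\<close>).

  Both constructions need finitely many nontrivial elements to have few fixed points on level \<open>n\<close>, which
  is what the Farber condition gives as \<open>n\<close> tends to infinity (\<open>few_fixed_vertices\<close>). The existence of Folner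
  sets is derived from the invariant mean through a paradoxical decomposition
  (\<open>amenable_Folner\<close>), which rests on an infinite marriage theorem.\<close>

section \<open>A marriage theorem for infinite families of finite sets\<close>

text \<open>Rado's argument. By Zorn's lemma, remove a maximal set of pairs from the relation
  \<open>Sigma I B\<close> such that Hall's condition survives; the union of a chain of removed sets is still
  admissible because Hall's condition for a finite \<open>J\<close> only sees finitely many pairs. What remains is
  a function: if \<open>i\<close> were still related to \<open>a\<close> and \<open>b\<close>, the removal of either pair would have to violate
  Hall's condition at some \<open>J\<close> and some \<open>L\<close>, and these two violations contradict Hall's condition
  for \<open>J \<union> L\<close> and \<open>J \<inter> L - {i}\<close>.\<close>

lemma infinite_marriage:
  fixes B :: "'i \<Rightarrow> 'v set"
  assumes fin: "\<And>i. i \<in> I \<Longrightarrow> finite (B i)"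
    and hall: "\<And>J. finite J \<Longrightarrow> J \<subseteq> I \<Longrightarrow> card J \<le> card (\<Union>i\<in>J. B i)"
  shows "\<exists>\<phi>. inj_on \<phi> I \<and> (\<forall>i\<in>I. \<phi> i \<in> B i)"
proof -
  define hallian where "hallian R \<longleftrightarrow> (\<forall>J. finite J \<longrightarrow> J \<subseteq> I \<longrightarrow> card J \<le> card (R `` J))"
    for R :: "('i \<times> 'v) set"
  \<comment> \<open>the members of \<open>\<A>\<close> are the sets of pairs that may be removed\<close>
  define \<A> where "\<A> = {D. D \<subseteq> Sigma I B \<and> hallian (Sigma I B - D)}"
  have Im: "Sigma I B `` J = (\<Union>i\<in>J. B i)" if "J \<subseteq> I" for J using that by blast
  have "{} \<in> \<A>" using hall Im by (simp add: \<A>_def hallian_def)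
  have "\<exists>M\<in>\<A>. \<forall>D\<in>\<A>. M \<subseteq> D \<longrightarrow> D = M"
  proof (rule subset_Zorn_nonempty)
    show "\<A> \<noteq> {}" using \<open>{} \<in> \<A>\<close> by blast
    fix \<C> assume \<C>: "\<C> \<noteq> {}" "subset.chain \<A> \<C>"
    have sub: "\<C> \<subseteq> \<A>" using \<C>(2) by (simp add: subset.chain_def)
    have "card J \<le> card ((Sigma I B - \<Union>\<C>) `` J)" if J: "finite J" "J \<subseteq> I" for J
    proof -
      have "finite (Sigma J B \<inter> \<Union>\<C>)" using J fin by (intro finite_Int disjI1 finite_SigmaI) auto
      then obtain D where D: "D \<in> \<C>" "Sigma J B \<inter> \<Union>\<C> \<subseteq> D"
        using finite_subset_Union_chain[OF _ _ \<C>] by (metis Int_lower2)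
      have "(Sigma I B - \<Union>\<C>) `` J = (Sigma I B - D) `` J" using D J by blast
      moreover have "hallian (Sigma I B - D)" using D sub by (auto simp: \<A>_def)
      ultimately show ?thesis using J unfolding hallian_def by metis
    qed
    moreover have "\<Union>\<C> \<subseteq> Sigma I B" using sub by (auto simp: \<A>_def)
    ultimately show "\<Union>\<C> \<in> \<A>" by (simp add: \<A>_def hallian_def)
  qed
  then obtain M where M: "M \<in> \<A>" and max: "\<forall>D\<in>\<A>. M \<subseteq> D \<longrightarrow> D = M" by (rule bexE)
  define R where "R = Sigma I B - M"
  have R: "card J \<le> card (R `` J)" if "finite J" "J \<subseteq> I" for J
  proof -
    have "hallian R" using M by (simp add: \<A>_def R_def)
    then show ?thesis using that unfolding hallian_def by blast
  qed
  have finR: "finite (R `` J)" if "finite J" "J \<subseteq> I" for J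
    by (rule finite_subset[of _ "\<Union>i\<in>J. B i"]) (use that fin in \<open>auto simp: R_def\<close>)
  have crit: "\<exists>J. finite J \<and> J \<subseteq> I \<and> i \<in> J \<and> card ((R - {(i, a)}) `` J) < card J"
    if "(i, a) \<in> R" for i a
  proof -
    have "insert (i, a) M \<notin> \<A>"
    proof
      assume "insert (i, a) M \<in> \<A>"
      then have "insert (i, a) M = M" using bspec[OF max] by blast
      then show False using that by (auto simp: R_def)
    qed
    moreover have "Sigma I B - insert (i, a) M = R - {(i, a)}" by (auto simp: R_def)
    moreover have "insert (i, a) M \<subseteq> Sigma I B" using M that by (auto simp: R_def \<A>_def)
    ultimately have "\<not> hallian (R - {(i, a)})" by (simp add: \<A>_def)
    then obtain J where J: "finite J" "J \<subseteq> I" "card ((R - {(i, a)}) `` J) < card J"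
      by (auto simp: hallian_def not_le)
    have "i \<in> J"
    proof (rule ccontr)
      assume "i \<notin> J"
      then have "(R - {(i, a)}) `` J = R `` J" by auto
      then show False using R[of J] J by simp
    qed
    then show ?thesis using J by blast
  qed
  \<comment> \<open>what remains after a maximal removal is single-valued\<close>
  have uniq: "a = b" if ab: "(i, a) \<in> R" "(i, b) \<in> R" for i a b
  proof (rule ccontr)
    assume ne: "a \<noteq> b"
    obtain J where J: "finite J" "J \<subseteq> I" "i \<in> J" "card ((R - {(i, a)}) `` J) < card J"
      using crit[OF ab(1)] by blast
    obtain L where L: "finite L" "L \<subseteq> I" "i \<in> L" "card ((R - {(i, b)}) `` L) < card L"
      using crit[OF ab(2)] by blast
    let ?U = "(R - {(i, a)}) `` J" and ?W = "(R - {(i, b)}) `` L"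
    have fin': "finite ?U" "finite ?W"
      using finR[OF J(1,2)] finR[OF L(1,2)] by (auto elim: finite_subset[rotated])
    have "R `` (J \<union> L) \<subseteq> ?U \<union> ?W"
    proof
      fix v assume "v \<in> R `` (J \<union> L)"
      then obtain j where j: "(j, v) \<in> R" "j \<in> J \<or> j \<in> L" by auto
      show "v \<in> ?U \<union> ?W"
      proof (cases "j = i")
        case True
        then have "(i, v) \<in> R - {(i, a)} \<or> (i, v) \<in> R - {(i, b)}" using j ne by auto
        then show ?thesis using J(3) L(3) by blast
      next
        case False
        then have "(j, v) \<in> R - {(i, a)}" "(j, v) \<in> R - {(i, b)}" using j by auto
        then show ?thesis using j(2) by blast
      qed
    qed
    then have "card (R `` (J \<union> L)) \<le> card (?U \<union> ?W)"
      using fin' by (intro card_mono) blast+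
    then have 1: "card (J \<union> L) \<le> card (?U \<union> ?W)"
      using R[of "J \<union> L"] J(1,2) L(1,2) by (meson Un_least finite_UnI le_trans)
    have "card (J \<inter> L - {i}) \<le> card (R `` (J \<inter> L - {i}))"
      by (rule R) (use J(1,2) in auto)
    moreover have "R `` (J \<inter> L - {i}) \<subseteq> ?U \<inter> ?W" by blast
    then have "card (R `` (J \<inter> L - {i})) \<le> card (?U \<inter> ?W)"
      using fin' by (intro card_mono) blast+
    ultimately have 2: "card (J \<inter> L) \<le> card (?U \<inter> ?W) + 1"
      using J(1,3) L(3) by simp
    show False
      using 1 2 card_Un_Int[OF fin'] card_Un_Int[OF J(1) L(1)] J(4) L(4) by linarith
  qed
  define \<phi> where "\<phi> i = (SOME v. (i, v) \<in> R)" for i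
  have \<phi>: "(i, \<phi> i) \<in> R" if "i \<in> I" for i
  proof -
    have "R `` {i} \<noteq> {}" using R[of "{i}"] that by (metis One_nat_def card.empty card.insert
          empty_iff finite.intros insert_subset empty_subsetI not_one_le_zero)
    then show ?thesis unfolding \<phi>_def by (metis Image_singleton_iff all_not_in_conv someI)
  qed
  have "inj_on \<phi> I"
  proof (rule inj_onI, rule ccontr)
    fix i j assume ij: "i \<in> I" "j \<in> I" "\<phi> i = \<phi> j" "i \<noteq> j"
    have "v = \<phi> i" if "(i, v) \<in> R \<or> (j, v) \<in> R" for v
      using that uniq[OF _ \<phi>[OF ij(1)]] uniq[OF _ \<phi>[OF ij(2)]] ij(3) by metis
    then have "R `` {i, j} \<subseteq> {\<phi> i}" by blast
    then have "card (R `` {i, j}) \<le> 1" using card_mono[of "{\<phi> i}"] by force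
    then show False using R[of "{i, j}"] ij by simp
  qed
  then show ?thesis using \<phi> by (auto simp: R_def)
qed

section \<open>Folner sets in amenable groups\<close>

lemma finitely_additive_UN:
  fixes m :: "'a set \<Rightarrow> real"
  assumes add: "\<And>A B. A \<subseteq> U \<Longrightarrow> B \<subseteq> U \<Longrightarrow> A \<inter> B = {} \<Longrightarrow> m (A \<union> B) = m A + m B"
    and "finite I" "\<And>i. i \<in> I \<Longrightarrow> A i \<subseteq> U" "disjoint_family_on A I"
  shows "m (\<Union>i\<in>I. A i) = (\<Sum>i\<in>I. m (A i))"
  using assms(2-)
proof (induction I)
  case empty
  show ?case using add[of "{}" "{}"] by simp
next
  case (insert i I)
  have "A i \<inter> (\<Union>i\<in>I. A i) = {}" "disjoint_family_on A I"
    using insert.hyps insert.prems(2) by (auto simp: disjoint_family_on_def)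
  moreover have "A i \<subseteq> U" "(\<Union>i\<in>I. A i) \<subseteq> U" using insert.prems(1) by auto
  ultimately show ?case using add[of "A i" "\<Union>i\<in>I. A i"] insert by simp
qed

context group
begin

text \<open>If left multiplication by \<open>T\<close> at least doubles every finite set, the marriage theorem assigns to
  the pairs \<open>(x, b)\<close>, for both values of \<open>b\<close>, pairwise distinct elements of \<open>T <#> {x}\<close>. For each \<open>b\<close>,
  cutting the group into the pieces on which this assignment is multiplication by a fixed \<open>t\<close> and
  translating the pieces gives two disjoint copies of the whole group: a paradoxical decomposition,
  which an invariant mean excludes.\<close>

lemma amenable_no_doubling:
  assumes am: "amenable G" and T: "finite T" "T \<subseteq> carrier G"
  shows "\<exists>E. finite E \<and> E \<subseteq> carrier G \<and> card (T <#> E) < 2 * card E"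
proof (rule ccontr)
  assume "\<not> ?thesis"
  then have dbl: "2 * card E \<le> card (T <#> E)" if "finite E" "E \<subseteq> carrier G" for E
    using that by (meson not_le)
  from am obtain m :: "'a set \<Rightarrow> real" where m: "m (carrier G) = 1"
      "\<forall>A. A \<subseteq> carrier G \<longrightarrow> 0 \<le> m A"
      "\<forall>A B. A \<subseteq> carrier G \<longrightarrow> B \<subseteq> carrier G \<longrightarrow> A \<inter> B = {} \<longrightarrow> m (A \<union> B) = m A + m B"
      "\<forall>A. \<forall>g\<in>carrier G. A \<subseteq> carrier G \<longrightarrow> m (g <# A) = m A"
    unfolding amenable_def by (elim exE conjE) (rule that)
  note m1 = m(1) and m0 = m(2)[rule_format] and madd = m(3)[rule_format] and minv = m(4)[rule_format]
  note msum = finitely_additive_UN[where U = "carrier G" and m = m, rotated 1]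
  have "\<exists>\<phi>. inj_on \<phi> (carrier G \<times> (UNIV :: bool set)) \<and>
      (\<forall>i\<in>carrier G \<times> UNIV. \<phi> i \<in> (\<lambda>t. t \<otimes> fst i) ` T)"
  proof (rule infinite_marriage)
    fix J :: "('a \<times> bool) set" assume J: "finite J" "J \<subseteq> carrier G \<times> UNIV"
    have "card J \<le> card (fst ` J \<times> (UNIV :: bool set))"
    proof (rule card_mono)
      show "J \<subseteq> fst ` J \<times> UNIV" by force
    qed (use J in auto)
    also have "\<dots> = 2 * card (fst ` J)" by (simp add: card_cartesian_product)
    also have "\<dots> \<le> card (T <#> fst ` J)" using J by (intro dbl) auto
    also have "T <#> fst ` J = (\<Union>i\<in>J. (\<lambda>t. t \<otimes> fst i) ` T)"
      by (auto simp: set_mult_def)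
    finally show "card J \<le> card (\<Union>i\<in>J. (\<lambda>t. t \<otimes> fst i) ` T)" .
  qed (use T in auto)
  then obtain \<phi> where inj: "inj_on \<phi> (carrier G \<times> (UNIV :: bool set))"
    and \<phi>: "\<And>x b. x \<in> carrier G \<Longrightarrow> \<phi> (x, b) \<in> (\<lambda>t. t \<otimes> x) ` T"
    by auto
  \<comment> \<open>the piece of the \<open>b\<close>-th copy on which the injection is multiplication by \<open>t\<close>\<close>
  define A where "A b t = {x \<in> carrier G. \<phi> (x, b) = t \<otimes> x}" for b t
  have A: "A b t \<subseteq> carrier G" for b t by (auto simp: A_def)
  have one: "(\<Sum>t\<in>T. m (A b t)) = 1" for b
  proof -
    have "m (\<Union>t\<in>T. A b t) = (\<Sum>t\<in>T. m (A b t))"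
    proof (rule msum[OF T(1) A _ madd])
      have "t = t'" if "t \<in> T" "t' \<in> T" "x \<in> A b t" "x \<in> A b t'" for t t' x
        using that T r_cancel[of t x t'] by (auto simp: A_def)
      then show "disjoint_family_on (A b) T" by (fastforce simp: disjoint_family_on_def)
    qed
    moreover have "(\<Union>t\<in>T. A b t) = carrier G" using \<phi>[of _ b] by (auto simp: A_def)
    ultimately show ?thesis using m1 by metis
  qed
  define P where "P = (\<lambda>(b, t). t <# A b t)"
  have P: "P (b, t) = \<phi> ` (A b t \<times> {b})" for b t
  proof -
    have "P (b, t) = (\<lambda>x. t \<otimes> x) ` A b t" by (auto simp: P_def l_coset_def)
    also have "\<dots> = (\<lambda>x. \<phi> (x, b)) ` A b t" by (rule image_cong) (auto simp: A_def)
    also have "\<dots> = \<phi> ` (A b t \<times> {b})" by auto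
    finally show ?thesis .
  qed
  have Psub: "P i \<subseteq> carrier G" if "i \<in> UNIV \<times> T" for i
  proof -
    obtain b t where "i = (b, t)" "t \<in> carrier G" using \<open>i \<in> UNIV \<times> T\<close> T by blast
    then show ?thesis using l_coset_subset_G[OF A] by (simp add: P_def)
  qed
  have disj: "disjoint_family_on P (UNIV \<times> T)"
  proof -
    have "(b, t) = (b', t')"
      if t: "t \<in> T" "t' \<in> T" and z: "z \<in> P (b, t)" "z \<in> P (b', t')" for b t b' t' z
    proof -
      obtain x where x: "x \<in> A b t" "z = \<phi> (x, b)" using z P by auto
      obtain y where y: "y \<in> A b' t'" "z = \<phi> (y, b')" using z P by auto
      have "(x, b) = (y, b')" using inj_onD[OF inj, of "(x, b)" "(y, b')"] x y A by auto
      then have "t \<otimes> x = t' \<otimes> x" "b = b'" "x \<in> carrier G" using x y by (auto simp: A_def)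
      then show ?thesis using t T r_cancel[of t x t'] by auto
    qed
    then show ?thesis unfolding disjoint_family_on_def by blast
  qed
  let ?U = "\<Union>i\<in>UNIV \<times> T. P i"
  have "m ?U = (\<Sum>i\<in>UNIV \<times> T. m (P i))"
    by (rule msum[OF _ Psub disj madd]) (use T in auto)
  also have "\<dots> = (\<Sum>b\<in>UNIV. \<Sum>t\<in>T. m (P (b, t)))" by (simp add: sum.cartesian_product)
  also have "\<dots> = (\<Sum>b\<in>UNIV. \<Sum>t\<in>T. m (A b t))"
    using T A minv by (intro sum.cong) (auto simp: P_def)
  also have "\<dots> = 2" using one by (simp add: UNIV_bool)
  finally have "m ?U = 2" .
  moreover have "m (?U \<union> (carrier G - ?U)) = m ?U + m (carrier G - ?U)"
    using Psub by (intro madd) auto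
  moreover have "?U \<union> (carrier G - ?U) = carrier G" using Psub by blast
  moreover have "m (carrier G - ?U) \<ge> 0" by (rule m0) auto
  ultimately show False using m1 by simp
qed

lemma finite_set_mult: "finite A \<Longrightarrow> finite B \<Longrightarrow> finite (A <#> B)"
  by (simp add: set_mult_def)

text \<open>If \<open>P\<close> expanded every finite set by the factor \<open>1 + \<eta>\<close>, a power of \<open>P\<close> would double every finite set.\<close>

lemma amenable_small_growth:
  fixes \<eta> :: real
  assumes am: "amenable G" and P: "finite P" "P \<subseteq> carrier G" and \<eta>: "0 < \<eta>"
  shows "\<exists>E. finite E \<and> E \<noteq> {} \<and> E \<subseteq> carrier G \<and> real (card (P <#> E)) \<le> (1 + \<eta>) * card E"
proof (rule ccontr)
  assume "\<not> ?thesis"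
  then have grow: "(1 + \<eta>) * card E \<le> real (card (P <#> E))" if "finite E" "E \<subseteq> carrier G" for E
    using that by (cases "E = {}") (auto simp: not_le intro: less_imp_le)
  define Q where "Q r = ((\<lambda>T. P <#> T) ^^ r) {\<one>}" for r
  have Q: "finite (Q r) \<and> Q r \<subseteq> carrier G" for r
    by (induction r) (use P finite_set_mult set_mult_closed in \<open>auto simp: Q_def\<close>)
  have QE: "(1 + \<eta>) ^ r * card E \<le> real (card (Q r <#> E))"
    if E: "finite E" "E \<subseteq> carrier G" for r E
  proof (induction r)
    case 0
    have "{\<one>} <#> E = E" using E by (force simp: set_mult_def)
    then show ?case by (simp add: Q_def)
  next
    case (Suc r)
    have "(1 + \<eta>) ^ Suc r * card E \<le> (1 + \<eta>) * card (Q r <#> E)"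
      using Suc \<eta> by (simp add: mult.assoc)
    also have "\<dots> \<le> card (P <#> (Q r <#> E))"
      using Q E by (intro grow finite_set_mult set_mult_closed) auto
    also have "P <#> (Q r <#> E) = Q (Suc r) <#> E"
      using set_mult_assoc[of P "Q r" E] P Q E by (simp add: Q_def)
    finally show ?case .
  qed
  obtain r where r: "2 < (1 + \<eta>) ^ r" using real_arch_pow[of "1 + \<eta>" 2] \<eta> by auto
  obtain E where E: "finite E" "E \<subseteq> carrier G" "card (Q r <#> E) < 2 * card E"
    using amenable_no_doubling[OF am, of "Q r"] Q by blast
  have "2 * real (card E) \<le> (1 + \<eta>) ^ r * card E" using r by (intro mult_right_mono) auto
  also have "\<dots> \<le> card (Q r <#> E)" using QE E by blast
  finally show False using E(3) by linarith
qed

text \<open>The invariant mean is left-invariant, whereas the boundary of \<open>F\<close> is needed for right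
  multiplication, so \<open>F\<close> consists of the inverses of a set with small growth.\<close>

lemma amenable_Folner:
  fixes \<eta> :: real
  assumes am: "amenable G" and K: "finite K" "K \<subseteq> carrier G" and \<eta>: "0 < \<eta>"
  shows "\<exists>F. finite F \<and> F \<noteq> {} \<and> F \<subseteq> carrier G \<and>
    real (card {f \<in> F. \<exists>k\<in>K. f \<otimes> k \<notin> F}) \<le> \<eta> * card F"
proof -
  define P where "P = insert \<one> (m_inv G ` K)"
  \<comment> \<open>the summand 1 keeps the quotient positive when \<open>K\<close> is empty\<close>
  define \<theta> where "\<theta> = \<eta> / (card K + 1)"
  have P: "finite P" "P \<subseteq> carrier G" using K by (auto simp: P_def)
  have "0 < \<theta>" using \<eta> by (simp add: \<theta>_def)
  then obtain E where E: "finite E" "E \<noteq> {}" "E \<subseteq> carrier G" "real (card (P <#> E)) \<le> (1 + \<theta>) * card E"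
    using amenable_small_growth[OF am P] by blast
  define F where "F = m_inv G ` E"
  have injE: "inj_on (m_inv G) E" using E(3) by (meson inj_onI inv_inj inj_on_subset)
  have cF: "card F = card E" using card_image[OF injE] by (simp add: F_def)
  have "E \<subseteq> P <#> E" using E by (force simp: P_def set_mult_def)
  then have D: "real (card ((P <#> E) - E)) \<le> \<theta> * card E"
  proof -
    have "card E \<le> card (P <#> E)" "card ((P <#> E) - E) = card (P <#> E) - card E"
      using card_mono[OF finite_set_mult[OF P(1) E(1)] \<open>E \<subseteq> P <#> E\<close>]
        card_Diff_subset[OF E(1) \<open>E \<subseteq> P <#> E\<close>] by blast+
    then show ?thesis using E(4) by (simp add: of_nat_diff algebra_simps)
  qed
  \<comment> \<open>\<open>f\<close> leaves \<open>F\<close> under \<open>k\<close> only if \<open>inv f = k \<otimes> z\<close> with \<open>z\<close> in \<open>(P <#> E) - E\<close>.\<close>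
  have "{f \<in> F. \<exists>k\<in>K. f \<otimes> k \<notin> F} \<subseteq> (\<lambda>(k, z). inv (k \<otimes> z)) ` (K \<times> ((P <#> E) - E))"
  proof
    fix f assume "f \<in> {f \<in> F. \<exists>k\<in>K. f \<otimes> k \<notin> F}"
    then obtain k e where k: "k \<in> K" "f \<otimes> k \<notin> F" and e: "e \<in> E" "f = inv e" by (auto simp: F_def)
    have c: "k \<in> carrier G" "e \<in> carrier G" using k e K E by auto
    let ?z = "inv k \<otimes> e"
    have "?z \<notin> E"
    proof
      assume "?z \<in> E"
      then have "inv ?z \<in> F" by (auto simp: F_def)
      then show False using k e c by (simp add: inv_mult_group)
    qed
    moreover have "?z \<in> P <#> E" using k e by (auto simp: set_mult_def P_def)
    moreover have "f = inv (k \<otimes> ?z)" using c e by (simp add: m_assoc[symmetric])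
    ultimately show "f \<in> (\<lambda>(k, z). inv (k \<otimes> z)) ` (K \<times> ((P <#> E) - E))" using k by force
  qed
  then have "card {f \<in> F. \<exists>k\<in>K. f \<otimes> k \<notin> F} \<le> card (K \<times> ((P <#> E) - E))"
    using K finite_set_mult[OF P(1) E(1)]
    by (intro order.trans[OF card_mono card_image_le]) auto
  then have "real (card {f \<in> F. \<exists>k\<in>K. f \<otimes> k \<notin> F}) \<le> card K * real (card ((P <#> E) - E))"
    by (simp add: card_cartesian_product flip: of_nat_mult)
  also have "\<dots> \<le> card K * (\<theta> * card E)" using D by (intro mult_left_mono) auto
  also have "\<dots> \<le> (card K + 1) * (\<theta> * card E)"
    using \<open>0 < \<theta>\<close> by (intro mult_right_mono) auto
  also have "\<dots> = \<eta> * card F" by (simp add: \<theta>_def cF)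
  finally show ?thesis using E by (intro exI[of _ F]) (auto simp: F_def)
qed

lemma conjugate_eq_one:
  assumes "f \<in> carrier G" "a \<in> carrier G" "b \<in> carrier G" "inv f \<otimes> (a \<otimes> inv b) \<otimes> f = \<one>"
  shows "a = b"
proof -
  let ?z = "a \<otimes> inv b"
  have "inv f \<otimes> (?z \<otimes> f) = \<one>" using assms by (simp add: m_assoc)
  then have "?z \<otimes> f = f" using inv_solve_left[of \<one> f "?z \<otimes> f"] assms(1-3) by simp
  then have "?z = \<one>" using assms(1-3) by simp
  then have "inv (inv b) = a" using assms(2,3) by (intro inv_equality) auto
  then show "a = b" using assms(3) by simp
qed

end

section \<open>The groupoid of an action and generators of stabilizers\<close>

locale right_action = group G for G (structure) +
  fixes \<Omega> :: "'x set" and act :: "'x \<Rightarrow> 'a \<Rightarrow> 'x" (infixl \<open>\<triangleleft>\<close> 75)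
  assumes act_closed: "x \<in> \<Omega> \<Longrightarrow> g \<in> carrier G \<Longrightarrow> x \<triangleleft> g \<in> \<Omega>"
    and act_one: "x \<in> \<Omega> \<Longrightarrow> x \<triangleleft> \<one> = x"
    and act_mult: "x \<in> \<Omega> \<Longrightarrow> g \<in> carrier G \<Longrightarrow> h \<in> carrier G \<Longrightarrow> x \<triangleleft> (g \<otimes> h) = x \<triangleleft> g \<triangleleft> h"
begin

lemma act_inv:
  assumes "x \<in> \<Omega>" "g \<in> carrier G"
  shows "x \<triangleleft> g \<triangleleft> inv g = x" "x \<triangleleft> inv g \<triangleleft> g = x"
  using assms by (simp_all add: act_mult[symmetric] act_one)

text \<open>A pair \<open>(x, g)\<close> stands for the arrow from \<open>x\<close> to \<open>x \<triangleleft> g\<close> in the groupoid of the action;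
  \<open>arrows E\<close> is the subgroupoid, with all objects, that \<open>E\<close> generates.\<close>

inductive_set arrows :: "('x \<times> 'a) set \<Rightarrow> ('x \<times> 'a) set" for E where
  identity: "x \<in> \<Omega> \<Longrightarrow> (x, \<one>) \<in> arrows E"
| generator: "(x, g) \<in> E \<Longrightarrow> (x, g) \<in> arrows E"
| inverse: "(x, g) \<in> arrows E \<Longrightarrow> (x \<triangleleft> g, inv g) \<in> arrows E"
| compose: "(x, g) \<in> arrows E \<Longrightarrow> (x \<triangleleft> g, h) \<in> arrows E \<Longrightarrow> (x, g \<otimes> h) \<in> arrows E"

lemma arrows_subset:
  assumes "(x, g) \<in> arrows E" "E \<subseteq> arrows E'"
  shows "(x, g) \<in> arrows E'"
  using assms(1)
proof (induction x g rule: arrows.induct)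
  case (generator x g)
  then show ?case using assms(2) by blast
qed (auto intro: arrows.intros)

lemma arrows_mono:
  assumes "E \<subseteq> E'" shows "arrows E \<subseteq> arrows E'"
proof (rule subrelI)
  have "E \<subseteq> arrows E'" using assms by (auto intro: arrows.generator)
  then show "(x, g) \<in> arrows E'" if "(x, g) \<in> arrows E" for x g
    using that by (rule arrows_subset[rotated])
qed

lemma arrows_carrier:
  assumes "(x, g) \<in> arrows E" "E \<subseteq> \<Omega> \<times> carrier G"
  shows "x \<in> \<Omega>" "g \<in> carrier G"
proof -
  have "x \<in> \<Omega> \<and> g \<in> carrier G"
    using assms by (induction x g rule: arrows.induct) (auto intro: act_closed)
  then show "x \<in> \<Omega>" "g \<in> carrier G" by auto
qed

lemma arrow_reverse:
  assumes "x \<in> \<Omega>" "g \<in> carrier G" "(x \<triangleleft> g, inv g) \<in> arrows E"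
  shows "(x, g) \<in> arrows E"
  using arrows.inverse[OF assms(3)] assms(1,2) by (simp add: act_inv)

lemma arrows_generate:
  assumes E: "E \<subseteq> \<Omega> \<times> carrier G" and S: "S \<subseteq> carrier G" and ES: "\<Omega> \<times> S \<subseteq> arrows E"
    and x: "x \<in> \<Omega>" and g: "g \<in> generate G S"
  shows "(x, g) \<in> arrows E"
  using g x
proof (induction arbitrary: x)
  case one
  then show ?case by (rule arrows.identity)
next
  case (incl h)
  then show ?case using ES by blast
next
  case (inv h)
  have "h \<in> carrier G" using inv S by blast
  moreover have "(x \<triangleleft> inv h, h) \<in> arrows E"
    using ES inv act_closed \<open>h \<in> carrier G\<close> by blast
  ultimately show ?case using arrow_reverse[of x "inv h" E] inv by simp
next
  case (eng h k)
  have "h \<in> carrier G" using generate_in_carrier[OF S] eng by blast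
  then show ?case using eng act_closed by (blast intro: arrows.compose)
qed

lemma arrows_invariant_set:
  assumes E: "E \<subseteq> \<Omega> \<times> carrier G" and Z: "Z \<subseteq> \<Omega>"
    and closed: "\<And>x g. (x, g) \<in> E \<Longrightarrow> x \<in> Z \<longleftrightarrow> x \<triangleleft> g \<in> Z"
    and a: "(x, g) \<in> arrows E"
  shows "x \<in> Z \<longleftrightarrow> x \<triangleleft> g \<in> Z"
  using a
proof (induction x g rule: arrows.induct)
  case (inverse x g)
  then have "x \<in> \<Omega>" "g \<in> carrier G" using arrows_carrier[OF _ E] by blast+
  then show ?case using inverse by (simp add: act_inv)
next
  case (compose x g h)
  then have "x \<in> \<Omega>" "g \<in> carrier G" "h \<in> carrier G" using arrows_carrier[OF _ E] by blast+
  then show ?case using compose by (simp add: act_mult)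
qed (simp_all add: act_one closed)

text \<open>A connected groupoid has a spanning tree among its generating arrows. The function \<open>\<tau>\<close> records the
  group element read along the tree from the root \<open>p\<close> to each point, so that along tree arrows \<open>\<tau>\<close>
  changes exactly by the label. The tree grows one point at a time: a generating arrow must cross the
  boundary of every proper subset containing \<open>p\<close>, in one of the two directions.\<close>

lemma spanning_tree:
  assumes E: "E \<subseteq> \<Omega> \<times> carrier G" and fin: "finite \<Omega>" and p: "p \<in> \<Omega>"
    and trans: "\<forall>x\<in>\<Omega>. \<exists>g. (p, g) \<in> arrows E \<and> p \<triangleleft> g = x"
  shows "\<exists>\<tau> T. T \<subseteq> E \<and> card T + 1 = card \<Omega> \<and> \<tau> p = \<one> \<and>
    (\<forall>x\<in>\<Omega>. \<tau> x \<in> carrier G \<and> p \<triangleleft> \<tau> x = x) \<and>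
    (\<forall>(x, g)\<in>T. \<tau> (x \<triangleleft> g) = \<tau> x \<otimes> g)"
proof -
  have partial: "\<exists>Z \<tau> T. Z \<subseteq> \<Omega> \<and> p \<in> Z \<and> card Z = Suc k \<and> T \<subseteq> E \<and> finite T \<and> card T = k \<and> \<tau> p = \<one> \<and>
      (\<forall>x\<in>Z. \<tau> x \<in> carrier G \<and> p \<triangleleft> \<tau> x = x) \<and>
      (\<forall>(x, g)\<in>T. x \<in> Z \<and> x \<triangleleft> g \<in> Z \<and> \<tau> (x \<triangleleft> g) = \<tau> x \<otimes> g)" if "Suc k \<le> card \<Omega>" for k
    using that
  proof (induction k)
    case 0
    show ?case
      by (rule exI[of _ "{p}"], rule exI[of _ "\<lambda>_. \<one>"], rule exI[of _ "{}"]) (use p act_one in auto)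
  next
    case (Suc k)
    then obtain Z \<tau> T where Z: "Z \<subseteq> \<Omega>" "p \<in> Z" "card Z = Suc k" and T: "T \<subseteq> E" "finite T" "card T = k"
      and \<tau>: "\<tau> p = \<one>" "\<forall>x\<in>Z. \<tau> x \<in> carrier G \<and> p \<triangleleft> \<tau> x = x"
      and T\<tau>: "\<forall>(x, g)\<in>T. x \<in> Z \<and> x \<triangleleft> g \<in> Z \<and> \<tau> (x \<triangleleft> g) = \<tau> x \<otimes> g"
      using Suc_leD by blast
    have "Z \<noteq> \<Omega>" using Suc.prems Z by auto
    then obtain y where y: "y \<in> \<Omega>" "y \<notin> Z" using Z by blast
    obtain g0 where g0: "(p, g0) \<in> arrows E" "p \<triangleleft> g0 = y" using bspec[OF trans y(1)] by blast
    have "\<not> (\<forall>(x, g)\<in>E. x \<in> Z \<longleftrightarrow> x \<triangleleft> g \<in> Z)"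
    proof
      assume "\<forall>(x, g)\<in>E. x \<in> Z \<longleftrightarrow> x \<triangleleft> g \<in> Z"
      then have "p \<in> Z \<longleftrightarrow> p \<triangleleft> g0 \<in> Z"
        by (intro arrows_invariant_set[OF E Z(1) _ g0(1)]) auto
      then show False using Z y g0 by simp
    qed
    then obtain x g where xg: "(x, g) \<in> E" "(x \<in> Z) \<noteq> (x \<triangleleft> g \<in> Z)" by auto
    have x: "x \<in> \<Omega>" and g: "g \<in> carrier G" and xg\<Omega>: "x \<triangleleft> g \<in> \<Omega>" using xg(1) E act_closed by auto
    \<comment> \<open>the crossing arrow may point into or out of \<open>Z\<close>; its label or the inverse extends \<open>\<tau>\<close>\<close>
    define new where "new = (if x \<in> Z then x \<triangleleft> g else x)"
    define \<tau>' where "\<tau>' = \<tau>(new := if x \<in> Z then \<tau> x \<otimes> g else \<tau> (x \<triangleleft> g) \<otimes> inv g)"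
    have new: "new \<in> \<Omega>" "new \<notin> Z" using x xg\<Omega> xg(2) by (auto simp: new_def)
    have old: "\<tau>' z = \<tau> z" if "z \<in> Z" for z using that new by (auto simp: \<tau>'_def)
    have notT: "(x, g) \<notin> T" using T\<tau> xg by auto
    have newval: "\<tau>' new \<in> carrier G \<and> p \<triangleleft> \<tau>' new = new"
    proof (cases "x \<in> Z")
      case True
      then show ?thesis using \<tau>(2) g p by (simp add: \<tau>'_def new_def act_mult)
    next
      case False
      then have "x \<triangleleft> g \<in> Z" using xg by blast
      then show ?thesis using False \<tau>(2) g p x by (simp add: \<tau>'_def new_def act_mult act_inv)
    qed
    have edge: "\<tau>' (x \<triangleleft> g) = \<tau>' x \<otimes> g"
    proof (cases "x \<in> Z")
      case True
      then show ?thesis using old[OF True] by (simp add: \<tau>'_def new_def)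
    next
      case False
      then have *: "x \<triangleleft> g \<in> Z" using xg by blast
      then have "\<tau> (x \<triangleleft> g) \<in> carrier G" using \<tau> by blast
      then show ?thesis using old[OF *] False g by (simp add: \<tau>'_def new_def m_assoc)
    qed
    show ?case
    proof (rule exI[of _ "insert new Z"], rule exI[of _ \<tau>'], rule exI[of _ "insert (x, g) T"], intro conjI)
      show "insert new Z \<subseteq> \<Omega>" "p \<in> insert new Z" using Z new by auto
      show "card (insert new Z) = Suc (Suc k)"
        using Z new finite_subset[OF Z(1) fin] by simp
      show "insert (x, g) T \<subseteq> E" "finite (insert (x, g) T)" "card (insert (x, g) T) = Suc k"
        using T xg notT by auto
      show "\<tau>' p = \<one>" using old Z \<tau> by simp
      show "\<forall>x\<in>insert new Z. \<tau>' x \<in> carrier G \<and> p \<triangleleft> \<tau>' x = x" using newval old \<tau> by auto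
      have "x \<in> insert new Z" "x \<triangleleft> g \<in> insert new Z" using xg by (auto simp: new_def)
      then show "\<forall>(x, g)\<in>insert (x, g) T. x \<in> insert new Z \<and> x \<triangleleft> g \<in> insert new Z \<and> \<tau>' (x \<triangleleft> g) = \<tau>' x \<otimes> g"
        using T\<tau> edge old by auto
    qed
  qed
  have "0 < card \<Omega>" using fin p card_gt_0_iff by blast
  then have k: "Suc (card \<Omega> - 1) = card \<Omega>" by simp
  obtain Z \<tau> T where Z: "Z \<subseteq> \<Omega>" "card Z = card \<Omega>" and *: "T \<subseteq> E" "card T = card \<Omega> - 1" "\<tau> p = \<one>"
      "\<forall>x\<in>Z. \<tau> x \<in> carrier G \<and> p \<triangleleft> \<tau> x = x" "\<forall>(x, g)\<in>T. x \<in> Z \<and> x \<triangleleft> g \<in> Z \<and> \<tau> (x \<triangleleft> g) = \<tau> x \<otimes> g"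
    using partial[of "card \<Omega> - 1", unfolded k, OF le_refl] by (elim exE conjE) (rule that)
  have "Z = \<Omega>" using Z fin card_subset_eq by blast
  then show ?thesis using * k by (intro exI[of _ \<tau>] exI[of _ T]) auto
qed

text \<open>Collapsing the spanning tree turns every arrow \<open>(x, g)\<close> into the element
  \<open>\<tau> x \<otimes> g \<otimes> inv (\<tau> (x \<triangleleft> g))\<close> of the stabilizer of \<open>p\<close>. This is a homomorphism of groupoids that is the
  identity on the stabilizer, so the images of the generating arrows generate the stabilizer; the
  \<open>card \<Omega> - 1\<close> tree arrows have trivial image. For the arrows \<open>\<Omega> \<times> S\<close> of a generating set
  \<open>S\<close> this is Schreier's bound.\<close>

lemma stabilizer_generators:
  assumes E: "E \<subseteq> \<Omega> \<times> carrier G" "finite E" and fin: "finite \<Omega>" and p: "p \<in> \<Omega>"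
    and all: "\<Omega> \<times> carrier G \<subseteq> arrows E"
    and trans: "\<And>x. x \<in> \<Omega> \<Longrightarrow> \<exists>g\<in>carrier G. p \<triangleleft> g = x"
  shows "\<exists>A. finite A \<and> card A + card \<Omega> \<le> card E + 1 \<and> A \<subseteq> {g \<in> carrier G. p \<triangleleft> g = p} \<and>
    {g \<in> carrier G. p \<triangleleft> g = p} \<subseteq> generate G A"
proof -
  have tr: "\<forall>x\<in>\<Omega>. \<exists>g. (p, g) \<in> arrows E \<and> p \<triangleleft> g = x"
    using trans all p by blast
  obtain \<tau> T where T: "T \<subseteq> E" "card T + 1 = card \<Omega>" and \<tau>p: "\<tau> p = \<one>"
    and \<tau>': "\<forall>x\<in>\<Omega>. \<tau> x \<in> carrier G \<and> p \<triangleleft> \<tau> x = x"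
    and T\<tau>: "\<forall>(x, g)\<in>T. \<tau> (x \<triangleleft> g) = \<tau> x \<otimes> g"
    using spanning_tree[OF E(1) fin p tr] by (elim exE conjE) (rule that)
  have \<tau>: "\<tau> x \<in> carrier G" "p \<triangleleft> \<tau> x = x" if "x \<in> \<Omega>" for x using \<tau>' that by auto
  define hol where "hol = (\<lambda>(x, g). \<tau> x \<otimes> g \<otimes> inv (\<tau> (x \<triangleleft> g)))"
  define A where "A = hol ` (E - T)"
  have hol: "hol (x, g) \<in> carrier G" "p \<triangleleft> hol (x, g) = p" if "x \<in> \<Omega>" "g \<in> carrier G" for x g
  proof -
    have c: "\<tau> x \<in> carrier G" "\<tau> (x \<triangleleft> g) \<in> carrier G" "p \<triangleleft> \<tau> x = x" "p \<triangleleft> \<tau> (x \<triangleleft> g) = x \<triangleleft> g"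
      using that \<tau> act_closed by auto
    then show "hol (x, g) \<in> carrier G" using that by (simp add: hol_def)
    have "p \<triangleleft> hol (x, g) = x \<triangleleft> g \<triangleleft> inv (\<tau> (x \<triangleleft> g))"
      using that c p by (simp add: hol_def act_mult)
    also have "\<dots> = p" using act_inv(1)[OF p c(2)] c by simp
    finally show "p \<triangleleft> hol (x, g) = p" .
  qed
  have A: "A \<subseteq> {g \<in> carrier G. p \<triangleleft> g = p}" using hol E by (auto simp: A_def)
  have "hol (x, g) \<in> generate G A" if "(x, g) \<in> arrows E" for x g
    using that
  proof (induction x g rule: arrows.induct)
    case (identity x)
    then have "hol (x, \<one>) = \<one>" using \<tau> by (simp add: hol_def act_one)
    then show ?case by (simp add: generate.one)
  next
    case (generator x g)
    then have c: "x \<in> \<Omega>" "g \<in> carrier G" using E by auto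
    show ?case
    proof (cases "(x, g) \<in> T")
      case True
      then have "hol (x, g) = \<one>" using bspec[OF T\<tau> True] \<tau> c act_closed[OF c] by (simp add: hol_def)
      then show ?thesis by (simp add: generate.one)
    next
      case False
      then have "hol (x, g) \<in> A" using generator by (auto simp: A_def)
      then show ?thesis by (rule generate.incl)
    qed
  next
    case (inverse x g)
    then have c: "x \<in> \<Omega>" "g \<in> carrier G" using arrows_carrier[OF _ E(1)] by blast+
    have "\<tau> x \<in> carrier G" "\<tau> (x \<triangleleft> g) \<in> carrier G" using c \<tau> act_closed by auto
    then have "hol (x \<triangleleft> g, inv g) = inv (hol (x, g))"
      using c by (simp add: hol_def act_inv inv_mult_group m_assoc)
    then show ?case using generate_m_inv_closed[OF _ inverse(2)] A by auto
  next
    case (compose x g h)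
    then have c: "x \<in> \<Omega>" "g \<in> carrier G" "h \<in> carrier G" using arrows_carrier[OF _ E(1)] by blast+
    have t: "\<tau> x \<in> carrier G" "\<tau> (x \<triangleleft> g) \<in> carrier G" "\<tau> (x \<triangleleft> g \<triangleleft> h) \<in> carrier G"
      using c \<tau> act_closed by auto
    have cancel: "inv u \<otimes> (u \<otimes> v) = v" if "u \<in> carrier G" "v \<in> carrier G" for u v
      using that by (simp add: m_assoc[symmetric])
    have "hol (x, g) \<otimes> hol (x \<triangleleft> g, h)
        = \<tau> x \<otimes> g \<otimes> (inv (\<tau> (x \<triangleleft> g)) \<otimes> (\<tau> (x \<triangleleft> g) \<otimes> (h \<otimes> inv (\<tau> (x \<triangleleft> g \<triangleleft> h)))))"
      using c t by (simp add: hol_def m_assoc)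
    also have "\<dots> = hol (x, g \<otimes> h)"
      using c t cancel by (simp add: hol_def act_mult m_assoc)
    finally show ?case using generate.eng[OF compose(3,4)] by simp
  qed
  then have "hol (p, g) \<in> generate G A" if "g \<in> carrier G" for g using all p that by blast
  moreover have "hol (p, g) = g" if "g \<in> carrier G" "p \<triangleleft> g = p" for g
    using that \<tau>p by (simp add: hol_def)
  ultimately have "{g \<in> carrier G. p \<triangleleft> g = p} \<subseteq> generate G A" by fastforce
  moreover have "card A + card \<Omega> \<le> card E + 1"
  proof -
    have "card A \<le> card (E - T)" unfolding A_def using E(2) by (intro card_image_le) auto
    also have "\<dots> = card E - card T" by (rule card_Diff_subset[OF finite_subset[OF T(1) E(2)] T(1)])
    finally show ?thesis using T(2) card_mono[OF E(2) T(1)] by linarith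
  qed
  moreover have "finite A" using E(2) by (simp add: A_def)
  ultimately show ?thesis using A by blast
qed

lemma conjugate_fixes:
  assumes "x \<in> \<Omega>" "f \<in> carrier G" "a \<in> carrier G" "b \<in> carrier G" "x \<triangleleft> a = x \<triangleleft> b"
  shows "x \<triangleleft> f \<triangleleft> (inv f \<otimes> (a \<otimes> inv b) \<otimes> f) = x \<triangleleft> f"
  using assms by (simp add: act_mult act_inv act_closed)

section \<open>Generating the groupoid of an almost free action cheaply\<close>

lemma sum_card_translates:
  assumes fin: "finite \<Omega>" "finite D" and D: "D \<subseteq> carrier G" and Y: "Y \<subseteq> \<Omega>"
  shows "(\<Sum>x\<in>\<Omega>. card {f \<in> D. x \<triangleleft> f \<in> Y}) = card D * card Y"
proof -
  have "(\<Sum>x\<in>\<Omega>. card {f \<in> D. x \<triangleleft> f \<in> Y}) = (\<Sum>f\<in>D. card {x \<in> \<Omega>. x \<triangleleft> f \<in> Y})"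
    by (rule sum_multicount_gen[OF fin]) auto
  also have "\<dots> = (\<Sum>f\<in>D. card Y)"
  proof (rule sum.cong)
    fix f assume "f \<in> D"
    then have f: "f \<in> carrier G" using D by blast
    have "bij_betw (\<lambda>x. x \<triangleleft> f) {x \<in> \<Omega>. x \<triangleleft> f \<in> Y} Y"
      by (rule bij_betw_byWitness[where f' = "\<lambda>x. x \<triangleleft> inv f"]) (use Y f in \<open>auto simp: act_inv act_closed\<close>)
    then show "card {x \<in> \<Omega>. x \<triangleleft> f \<in> Y} = card Y" by (rule bij_betw_same_card)
  qed simp
  finally show ?thesis by simp
qed

text \<open>Averaging over the base point \<open>x\<close>: each \<open>f\<close> in \<open>F\<close> carries exactly \<open>card Y\<close> base points into \<open>Y\<close>, so
  the elements of \<open>D\<close> make up at most the proportion \<open>\<eta>\<close> of all incidences of translates of \<open>F\<close> with \<open>Y\<close>,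
  and hence of the incidences of at least one translate that meets \<open>Y\<close>.\<close>

lemma exists_invariant_tile:
  fixes \<eta> :: real
  assumes fin: "finite \<Omega>" and Y: "Y \<subseteq> \<Omega>" "Y \<noteq> {}"
    and F: "finite F" "F \<noteq> {}" "F \<subseteq> carrier G" and D: "D \<subseteq> F" "real (card D) \<le> \<eta> * card F"
  shows "\<exists>x\<in>\<Omega>. {f \<in> F. x \<triangleleft> f \<in> Y} \<noteq> {} \<and>
    real (card {f \<in> D. x \<triangleleft> f \<in> Y}) \<le> \<eta> * card {f \<in> F. x \<triangleleft> f \<in> Y}"
proof (rule ccontr)
  let ?a = "\<lambda>x. card {f \<in> F. x \<triangleleft> f \<in> Y}" and ?b = "\<lambda>x. card {f \<in> D. x \<triangleleft> f \<in> Y}"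
  assume "\<not> ?thesis"
  then have neg: "{f \<in> F. x \<triangleleft> f \<in> Y} \<noteq> {} \<Longrightarrow> \<eta> * ?a x < ?b x" if "x \<in> \<Omega>" for x
    using that by force
  have finD: "finite D" "D \<subseteq> carrier G" using finite_subset[OF D(1) F(1)] D(1) F(3) by auto
  have le: "\<eta> * ?a x \<le> ?b x" if "x \<in> \<Omega>" for x
  proof (cases "{f \<in> F. x \<triangleleft> f \<in> Y} = {}")
    case True
    moreover have "?b x = 0" using True D(1) by (simp add: card_eq_0_iff) blast
    ultimately show ?thesis by (simp only: card.empty)
  next
    case False
    then show ?thesis using neg[OF that] by simp
  qed
  obtain y f where y: "y \<in> Y" "f \<in> F" using Y F by blast
  then have "y \<triangleleft> inv f \<in> \<Omega>" "y \<triangleleft> inv f \<triangleleft> f = y" using Y F by (auto simp: act_inv act_closed subset_iff)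
  then have "\<exists>x\<in>\<Omega>. \<eta> * ?a x < ?b x" using neg y by fastforce
  then have "(\<Sum>x\<in>\<Omega>. \<eta> * ?a x) < (\<Sum>x\<in>\<Omega>. real (?b x))"
    using fin le by (intro sum_strict_mono_ex1) auto
  then have "\<eta> * real (\<Sum>x\<in>\<Omega>. ?a x) < real (\<Sum>x\<in>\<Omega>. ?b x)"
    by (simp add: sum_distrib_left)
  then have "\<eta> * (card F * card Y) < card D * card Y"
    using sum_card_translates[OF fin F(1,3) Y(1)] sum_card_translates[OF fin finD Y(1)] by simp
  moreover have "real (card D) * card Y \<le> \<eta> * card F * card Y"
    using D(2) by (intro mult_right_mono) auto
  ultimately show False by (simp add: mult.assoc)
qed

text \<open>The quantitative form of the hyperfiniteness of actions of amenable groups. Tiles \<open>W = x \<triangleleft> F \<inter> Y\<close>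
  are split off from \<open>Y\<close> one after the other, where \<open>Y\<close> stands for what is still left; each is chosen so that
  at most the proportion \<open>\<eta>\<close> of its points comes from the Folner boundary of \<open>F\<close>, which is possible
  until \<open>Y\<close> is exhausted. In each tile a star
  of arrows from one of its points generates every arrow \<open>(y, k)\<close> that does not start at the
  boundary, and the boundary points are collected in \<open>C\<close>. An arrow between two tiles starts or ends in
  the tile that was removed first, at a boundary point of it. The freeness
  hypothesis makes the labels inside a tile unambiguous.\<close>

lemma tiling_arrows:
  fixes \<eta> :: real
  assumes fin: "finite \<Omega>"
    and K: "K \<subseteq> carrier G" "\<And>k. k \<in> K \<Longrightarrow> inv k \<in> K"
    and F: "finite F" "F \<noteq> {}" "F \<subseteq> carrier G"
    and Folner: "real (card {f \<in> F. \<exists>k\<in>K. f \<otimes> k \<notin> F}) \<le> \<eta> * card F"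
    and Y: "Y \<subseteq> \<Omega>"
    and free: "\<And>x f a b. x \<in> \<Omega> \<Longrightarrow> f \<in> F \<Longrightarrow> x \<triangleleft> f \<in> Y \<Longrightarrow> a \<in> F \<Longrightarrow> b \<in> F \<Longrightarrow> x \<triangleleft> a = x \<triangleleft> b \<Longrightarrow> a = b"
  shows "\<exists>E C. E \<subseteq> \<Omega> \<times> carrier G \<and> finite E \<and> card E \<le> card Y \<and> C \<subseteq> Y \<and> real (card C) \<le> \<eta> * card Y \<and>
    (\<forall>y\<in>Y. \<forall>k\<in>K. y \<triangleleft> k \<in> Y \<longrightarrow> (y, k) \<in> arrows (E \<union> C \<times> K))"
  using Y free
proof (induction "card Y" arbitrary: Y rule: less_induct)
  case less
  note Y = less.prems(1) and free = less.prems(2)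
  show ?case
  proof (cases "Y = {}")
    case True
    then show ?thesis by (intro exI[of _ "{}"]) auto
  next
    case False
    define D where "D = {f \<in> F. \<exists>k\<in>K. f \<otimes> k \<notin> F}"
    obtain x where x: "x \<in> \<Omega>" and ne: "{f \<in> F. x \<triangleleft> f \<in> Y} \<noteq> {}"
      and small: "real (card {f \<in> D. x \<triangleleft> f \<in> Y}) \<le> \<eta> * card {f \<in> F. x \<triangleleft> f \<in> Y}"
      using exists_invariant_tile[OF fin Y False F, of D \<eta>] Folner by (auto simp: D_def)
    define F' where "F' = {f \<in> F. x \<triangleleft> f \<in> Y}"
    define W where "W = (\<lambda>f. x \<triangleleft> f) ` F'"
    obtain f0 where f0: "f0 \<in> F'" using ne by (auto simp: F'_def)
    have F': "finite F'" "F' \<subseteq> carrier G" "F' \<subseteq> F" using F by (auto simp: F'_def)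
    have xfree: "a = b" if "a \<in> F" "b \<in> F" "x \<triangleleft> a = x \<triangleleft> b" for a b
      using free[OF x, of f0 a b] f0 that by (auto simp: F'_def)
    have finY: "finite Y" using Y fin by (rule finite_subset)
    have W: "W \<subseteq> Y" "W \<noteq> {}" "finite W" using f0 F'(1) by (auto simp: W_def F'_def)
    have "inj_on (\<lambda>f. x \<triangleleft> f) F'" using xfree F'(3) by (intro inj_onI) blast
    then have cW: "card W = card F'" unfolding W_def by (rule card_image)
    have cY: "card (Y - W) + card W = card Y"
      using card_Diff_subset[OF W(3,1)] card_mono[OF finY W(1)] by simp
    have "card W > 0" using W by (simp add: card_gt_0_iff)
    have free': "a = b" if "z \<in> \<Omega>" "f \<in> F" "z \<triangleleft> f \<in> Y - W" "a \<in> F" "b \<in> F" "z \<triangleleft> a = z \<triangleleft> b" for z f a b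
      using free[of z f a b] that by blast
    have "card (Y - W) < card Y" "Y - W \<subseteq> \<Omega>" using cY \<open>card W > 0\<close> Y by auto
    from less.hyps[OF this] free' have "\<exists>E C. E \<subseteq> \<Omega> \<times> carrier G \<and> finite E \<and> card E \<le> card (Y - W) \<and>
        C \<subseteq> Y - W \<and> real (card C) \<le> \<eta> * card (Y - W) \<and>
        (\<forall>y\<in>Y - W. \<forall>k\<in>K. y \<triangleleft> k \<in> Y - W \<longrightarrow> (y, k) \<in> arrows (E \<union> C \<times> K))"
      by (simp only:)
    then obtain E1 C1 where E1: "E1 \<subseteq> \<Omega> \<times> carrier G" "finite E1" "card E1 \<le> card (Y - W)"
        and C1: "C1 \<subseteq> Y - W" "real (card C1) \<le> \<eta> * card (Y - W)"
        and IH: "\<forall>y\<in>Y - W. \<forall>k\<in>K. y \<triangleleft> k \<in> Y - W \<longrightarrow> (y, k) \<in> arrows (E1 \<union> C1 \<times> K)"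
      by (elim exE conjE) (rule that)
    \<comment> \<open>the star of the tile, centred at \<open>x \<triangleleft> f0\<close>, and the boundary points of the tile\<close>
    define E2 where "E2 = (\<lambda>f. (x \<triangleleft> f0, inv f0 \<otimes> f)) ` F'"
    define C2 where "C2 = (\<lambda>f. x \<triangleleft> f) ` {f \<in> D. x \<triangleleft> f \<in> Y}"
    have finD: "finite {f \<in> D. x \<triangleleft> f \<in> Y}" using F by (simp add: D_def)
    have "card E2 \<le> card W" unfolding E2_def cW using F'(1) by (rule card_image_le)
    have C2: "C2 \<subseteq> W" by (auto simp: C2_def W_def F'_def D_def)
    have "real (card C2) \<le> card {f \<in> D. x \<triangleleft> f \<in> Y}"
      unfolding C2_def using card_image_le[OF finD] by simp
    also have "\<dots> \<le> \<eta> * card W" using small cW by (simp add: F'_def)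
    finally have cC2: "real (card C2) \<le> \<eta> * card W" .
    let ?E = "E1 \<union> E2" and ?C = "C1 \<union> C2"
    have key: "(y, k) \<in> arrows (?E \<union> ?C \<times> K)" if y: "y \<in> W" and k: "k \<in> K" and yk: "y \<triangleleft> k \<in> Y" for y k
    proof -
      obtain f where f: "f \<in> F'" "y = x \<triangleleft> f" using y by (auto simp: W_def)
      show ?thesis
      proof (cases "f \<in> D")
        case True
        then have "y \<in> C2" using f by (auto simp: C2_def F'_def)
        then show ?thesis using k by (auto intro: arrows.generator)
      next
        case False
        have c: "f \<in> carrier G" "k \<in> carrier G" "f0 \<in> carrier G" using f f0 F' k K by auto
        have "f \<otimes> k \<in> F" using False f k F' by (auto simp: D_def)
        moreover have "x \<triangleleft> (f \<otimes> k) \<in> Y" using yk f c x by (simp add: act_mult)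
        ultimately have fk: "f \<otimes> k \<in> F'" by (simp add: F'_def)
        \<comment> \<open>\<open>(y, k)\<close> runs back along one ray of the star and out along another\<close>
        have star: "(x \<triangleleft> f0, inv f0 \<otimes> h) \<in> arrows (?E \<union> ?C \<times> K)" if "h \<in> F'" for h
          using that by (intro arrows.generator) (auto simp: E2_def)
        have end_f: "x \<triangleleft> f0 \<triangleleft> (inv f0 \<otimes> f) = y"
          using x c f by (simp add: act_mult act_inv act_closed)
        have "(y, inv (inv f0 \<otimes> f)) \<in> arrows (?E \<union> ?C \<times> K)"
          using arrows.inverse[OF star[OF f(1)]] end_f by simp
        moreover have "y \<triangleleft> inv (inv f0 \<otimes> f) = x \<triangleleft> f0"
          using end_f act_inv(1)[of "x \<triangleleft> f0" "inv f0 \<otimes> f"] x c act_closed by auto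
        ultimately have "(y, inv (inv f0 \<otimes> f) \<otimes> (inv f0 \<otimes> (f \<otimes> k))) \<in> arrows (?E \<union> ?C \<times> K)"
          using arrows.compose[of y "inv (inv f0 \<otimes> f)"] star[OF fk] by metis
        moreover have "inv (inv f0 \<otimes> f) \<otimes> (inv f0 \<otimes> (f \<otimes> k)) = k"
        proof -
          have "inv f0 \<otimes> (f \<otimes> k) = (inv f0 \<otimes> f) \<otimes> k" using c by (simp add: m_assoc)
          then show ?thesis using c by (simp add: inv_solve_left')
        qed
        ultimately show ?thesis by simp
      qed
    qed
    have gen: "(y, k) \<in> arrows (?E \<union> ?C \<times> K)" if y: "y \<in> Y" and k: "k \<in> K" and yk: "y \<triangleleft> k \<in> Y" for y k
    proof (cases "y \<in> W")
      case True
      then show ?thesis using key k yk by blast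
    next
      case False
      show ?thesis
      proof (cases "y \<triangleleft> k \<in> W")
        case True
        have c: "y \<in> \<Omega>" "k \<in> carrier G" using y Y k K by auto
        then have "(y \<triangleleft> k, inv k) \<in> arrows (?E \<union> ?C \<times> K)"
          using key[OF True K(2)[OF k]] y by (simp add: act_inv)
        then show ?thesis by (rule arrow_reverse[OF c])
      next
        case 2: False
        then have "(y, k) \<in> arrows (E1 \<union> C1 \<times> K)" using IH y yk k False by blast
        moreover have "E1 \<union> C1 \<times> K \<subseteq> ?E \<union> ?C \<times> K" by blast
        ultimately show ?thesis using arrows_mono by blast
      qed
    qed
    have "E2 \<subseteq> \<Omega> \<times> carrier G" using x F' f0 act_closed by (auto simp: E2_def)
    moreover have "card ?E \<le> card Y"
      using card_Un_le[of E1 E2] E1 \<open>card E2 \<le> card W\<close> cY by linarith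
    moreover have "real (card ?C) \<le> \<eta> * card Y"
    proof -
      have "real (card ?C) \<le> real (card C1) + card C2" using card_Un_le[of C1 C2] by linarith
      also have "\<dots> \<le> \<eta> * (real (card (Y - W)) + card W)" using C1 cC2 by (simp add: distrib_left)
      also have "\<dots> = \<eta> * card Y" using cY by (simp flip: of_nat_add)
      finally show ?thesis .
    qed
    moreover have "finite E2" using F' by (simp add: E2_def)
    moreover have "?C \<subseteq> Y" using C1 C2 W(1) by blast
    ultimately show ?thesis using E1 gen by (intro exI[of _ ?E] exI[of _ ?C]) blast
  qed
qed

text \<open>Take a maximal family \<open>A\<close> of points with pairwise disjoint translates of \<open>M\<close>. Outside \<open>B\<close> these
  translates have \<open>card M\<close> points, so there are few of them, and by maximality the translate of any
  other point outside \<open>B\<close> meets one of them. The points of \<open>B\<close> are added to the section.\<close>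

lemma sparse_section:
  assumes fin: "finite \<Omega>" and M: "finite M" "M \<noteq> {}" "M \<subseteq> carrier G"
    and B: "B \<subseteq> \<Omega>"
    and free: "\<And>x a b. x \<in> \<Omega> - B \<Longrightarrow> a \<in> M \<Longrightarrow> b \<in> M \<Longrightarrow> x \<triangleleft> a = x \<triangleleft> b \<Longrightarrow> a = b"
  shows "\<exists>A\<subseteq>\<Omega>. real (card A) \<le> card \<Omega> / card M + card B \<and>
    (\<forall>x\<in>\<Omega>. \<exists>a\<in>M. \<exists>b\<in>M. x \<triangleleft> (a \<otimes> inv b) \<in> A)"
proof -
  define packing where "packing A \<longleftrightarrow> A \<subseteq> \<Omega> - B \<and> disjoint_family_on (\<lambda>x. (\<lambda>a. x \<triangleleft> a) ` M) A" for A
  have "packing {}" by (simp add: packing_def disjoint_family_on_def)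
  moreover have "\<forall>A. packing A \<longrightarrow> card A < Suc (card \<Omega>)"
    using fin by (auto simp: packing_def less_Suc_eq_le intro: card_mono)
  ultimately have "\<exists>A. packing A \<and> (\<forall>A'. packing A' \<longrightarrow> card A' \<le> card A)"
    by (rule ex_has_greatest_nat)
  then obtain A where A: "packing A" and max: "\<forall>A'. packing A' \<longrightarrow> card A' \<le> card A"
    by (elim exE conjE) (rule that)
  have sub: "A \<subseteq> \<Omega> - B" and disj: "disjoint_family_on (\<lambda>x. (\<lambda>a. x \<triangleleft> a) ` M) A"
    using A by (auto simp: packing_def)
  have finA: "finite A" using sub fin finite_subset by blast
  have "card A * card M = (\<Sum>x\<in>A. card ((\<lambda>a. x \<triangleleft> a) ` M))"
  proof -
    have "card ((\<lambda>a. x \<triangleleft> a) ` M) = card M" if "x \<in> A" for x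
      using free[of x] that sub by (intro card_image inj_onI) blast
    then show ?thesis by simp
  qed
  also have "\<dots> = card (\<Union>x\<in>A. (\<lambda>a. x \<triangleleft> a) ` M)"
    using finA M disj by (intro card_UN_disjoint[symmetric]) (auto simp: disjoint_family_on_def)
  also have "\<dots> \<le> card \<Omega>"
    using fin sub M act_closed by (intro card_mono) auto
  finally have "card A * card M \<le> card \<Omega>" .
  then have "real (card A) * card M \<le> card \<Omega>" by (simp flip: of_nat_mult)
  moreover have "card M > 0" using M by (simp add: card_gt_0_iff)
  ultimately have cA: "real (card A) \<le> card \<Omega> / card M" by (simp add: field_simps)
  \<comment> \<open>a point of \<open>A \<union> B\<close> is reached from itself with \<open>a = b\<close>\<close>
  have hit: "\<exists>a\<in>M. \<exists>b\<in>M. x \<triangleleft> (a \<otimes> inv b) \<in> A \<union> B" if x: "x \<in> \<Omega>" for x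
  proof (cases "x \<in> A \<union> B")
    case True
    obtain a where "a \<in> M" using M by blast
    then show ?thesis using True M x by (intro bexI[of _ a]) (auto simp: act_one r_inv subset_iff)
  next
    case False
    then have "\<not> packing (insert x A)" using max[rule_format, of "insert x A"] finA by auto
    moreover have "insert x A \<subseteq> \<Omega> - B" using False x sub by blast
    ultimately have "\<not> disjoint_family_on (\<lambda>x. (\<lambda>a. x \<triangleleft> a) ` M) (insert x A)"
      by (simp add: packing_def)
    then have "\<exists>y\<in>A. (\<lambda>a. x \<triangleleft> a) ` M \<inter> (\<lambda>a. y \<triangleleft> a) ` M \<noteq> {}"
      using disj by (simp add: disjoint_family_on_def) blast
    then obtain y a b where y: "y \<in> A" and ab: "a \<in> M" "b \<in> M" "x \<triangleleft> a = y \<triangleleft> b" by blast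
    have "y \<in> \<Omega>" "a \<in> carrier G" "b \<in> carrier G" using y sub ab M by auto
    then have "x \<triangleleft> (a \<otimes> inv b) = y" using x ab by (simp add: act_mult act_inv)
    then show ?thesis using y ab by blast
  qed
  have "real (card (A \<union> B)) \<le> card \<Omega> / card M + card B"
    using card_Un_le[of A B] cA by linarith
  then show ?thesis using hit sub B by (intro exI[of _ "A \<union> B"]) blast
qed

text \<open>The set \<open>K\<close> lies in the amenable normal subgroup in the application. All arrows labelled by \<open>K\<close>
  cost about \<open>card \<Omega>\<close> arrows, by the tiling. A generator \<open>s\<close> is then only needed on a sparse
  section \<open>A\<close>: from any \<open>x\<close> one moves into \<open>A\<close> by some \<open>l\<close> in \<open>K\<close>, applies \<open>s\<close>, and corrects by
  \<open>inv s \<otimes> inv l \<otimes> s\<close>, which is again in \<open>K\<close>. The points of \<open>B\<close>, where the action is not free enough, carry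
  all their \<open>K\<close>-arrows as generators.\<close>

lemma cheap_generating_arrows:
  fixes \<eta> \<delta> :: real
  assumes fin: "finite \<Omega>" and S: "finite S" "S \<subseteq> carrier G" "generate G S = carrier G"
    and M: "finite M" "M \<noteq> {}" "M \<subseteq> carrier G"
    and K: "finite K" "K \<subseteq> carrier G" "\<And>k. k \<in> K \<Longrightarrow> inv k \<in> K"
    and MK: "\<And>a b. a \<in> M \<Longrightarrow> b \<in> M \<Longrightarrow> a \<otimes> inv b \<in> K"
    and conjK: "\<And>a b s. a \<in> M \<Longrightarrow> b \<in> M \<Longrightarrow> s \<in> S \<Longrightarrow> inv s \<otimes> (b \<otimes> inv a) \<otimes> s \<in> K"
    and F: "finite F" "F \<noteq> {}" "F \<subseteq> carrier G"
    and Folner: "real (card {f \<in> F. \<exists>k\<in>K. f \<otimes> k \<notin> F}) \<le> \<eta> * card F" and \<eta>: "0 \<le> \<eta>"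
    and B: "B \<subseteq> \<Omega>" "real (card B) \<le> \<delta> * card \<Omega>"
    and freeM: "\<And>x a b. x \<in> \<Omega> - B \<Longrightarrow> a \<in> M \<Longrightarrow> b \<in> M \<Longrightarrow> x \<triangleleft> a = x \<triangleleft> b \<Longrightarrow> a = b"
    and freeF: "\<And>x f a b. x \<in> \<Omega> \<Longrightarrow> f \<in> F \<Longrightarrow> x \<triangleleft> f \<in> \<Omega> - B \<Longrightarrow> a \<in> F \<Longrightarrow> b \<in> F \<Longrightarrow>
      x \<triangleleft> a = x \<triangleleft> b \<Longrightarrow> a = b"
  shows "\<exists>E. E \<subseteq> \<Omega> \<times> carrier G \<and> finite E \<and> \<Omega> \<times> carrier G \<subseteq> arrows E \<and>
    real (card E) \<le> (1 + (card K * (\<eta> + \<delta>) + card S * (1 / card M + \<delta>))) * card \<Omega>"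
proof -
  have "\<exists>E C. E \<subseteq> \<Omega> \<times> carrier G \<and> finite E \<and> card E \<le> card (\<Omega> - B) \<and> C \<subseteq> \<Omega> - B \<and>
      real (card C) \<le> \<eta> * card (\<Omega> - B) \<and>
      (\<forall>y\<in>\<Omega> - B. \<forall>k\<in>K. y \<triangleleft> k \<in> \<Omega> - B \<longrightarrow> (y, k) \<in> arrows (E \<union> C \<times> K))"
    by (rule tiling_arrows[OF fin K(2,3) F Folner _ freeF]) auto
  then obtain E1 C where E1: "E1 \<subseteq> \<Omega> \<times> carrier G" "finite E1" "card E1 \<le> card (\<Omega> - B)"
    and C: "C \<subseteq> \<Omega> - B" "real (card C) \<le> \<eta> * card (\<Omega> - B)"
    and tile: "\<forall>y\<in>\<Omega> - B. \<forall>k\<in>K. y \<triangleleft> k \<in> \<Omega> - B \<longrightarrow> (y, k) \<in> arrows (E1 \<union> C \<times> K)"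
    by (elim exE conjE) (rule that)
  have "\<exists>A\<subseteq>\<Omega>. real (card A) \<le> card \<Omega> / card M + card B \<and>
      (\<forall>x\<in>\<Omega>. \<exists>a\<in>M. \<exists>b\<in>M. x \<triangleleft> (a \<otimes> inv b) \<in> A)"
    by (rule sparse_section[OF fin M B(1) freeM])
  then obtain A where A: "A \<subseteq> \<Omega>" "real (card A) \<le> card \<Omega> / card M + card B"
    and hit: "\<forall>x\<in>\<Omega>. \<exists>a\<in>M. \<exists>b\<in>M. x \<triangleleft> (a \<otimes> inv b) \<in> A"
    by (elim exE conjE) (rule that)
  define E where "E = E1 \<union> (C \<union> B) \<times> K \<union> A \<times> S"
  have Esub: "E \<subseteq> \<Omega> \<times> carrier G" using E1(1) C(1) B(1) K(2) A(1) S(2) unfolding E_def by blast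
  have "finite C" "finite B" "finite A"
    using finite_subset[OF _ fin] C(1) B(1) A(1) by blast+
  then have finE: "finite E" using E1(2) K(1) S(1) by (simp add: E_def)
  have genB: "(x, k) \<in> arrows E" if "x \<in> B" "k \<in> K" for x k
    using that by (auto simp: E_def intro: arrows.generator)
  have genK: "(x, k) \<in> arrows E" if x: "x \<in> \<Omega>" and k: "k \<in> K" for x k
  proof -
    have kc: "k \<in> carrier G" using k K(2) by blast
    consider "x \<in> B" | "x \<triangleleft> k \<in> B" | "x \<in> \<Omega> - B" "x \<triangleleft> k \<in> \<Omega> - B"
      using x act_closed[OF x kc] by blast
    then show ?thesis
    proof cases
      case 1
      then show ?thesis using genB k by blast
    next
      case 2
      then show ?thesis using genB[OF 2 K(3)[OF k]] arrow_reverse[OF x kc] by blast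
    next
      case 3
      then have "(x, k) \<in> arrows (E1 \<union> C \<times> K)" using tile k by blast
      moreover have "E1 \<union> C \<times> K \<subseteq> E" by (auto simp: E_def)
      ultimately show ?thesis using arrows_mono by blast
    qed
  qed
  have "(x, s) \<in> arrows E" if x: "x \<in> \<Omega>" and s: "s \<in> S" for x s
  proof -
    obtain a b where ab: "a \<in> M" "b \<in> M" and "x \<triangleleft> (a \<otimes> inv b) \<in> A" using hit x by blast
    define l where "l = a \<otimes> inv b"
    have abc: "a \<in> carrier G" "b \<in> carrier G" using ab M(3) by auto
    then have c: "l \<in> carrier G" "s \<in> carrier G" using s S(2) by (auto simp: l_def)
    have lK: "l \<in> K" using MK ab by (simp add: l_def)
    have "inv l = b \<otimes> inv a" using abc by (simp add: l_def inv_mult_group)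
    then have conj: "inv s \<otimes> inv l \<otimes> s \<in> K" using conjK[OF ab s] by simp
    have "x \<triangleleft> l \<in> A" using \<open>x \<triangleleft> (a \<otimes> inv b) \<in> A\<close> by (simp add: l_def)
    then have "(x \<triangleleft> l, s) \<in> arrows E" using s by (auto simp: E_def intro: arrows.generator)
    then have "(x, l \<otimes> s) \<in> arrows E" by (rule arrows.compose[OF genK[OF x lK]])
    moreover have "(x \<triangleleft> (l \<otimes> s), inv s \<otimes> inv l \<otimes> s) \<in> arrows E"
      using genK[OF _ conj] act_closed[OF x] c by simp
    ultimately have "(x, l \<otimes> s \<otimes> (inv s \<otimes> inv l \<otimes> s)) \<in> arrows E" by (rule arrows.compose)
    moreover have "l \<otimes> s \<otimes> (inv s \<otimes> inv l \<otimes> s) = s"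
    proof -
      have "l \<otimes> s \<otimes> (inv s \<otimes> inv l \<otimes> s) = l \<otimes> s \<otimes> inv (l \<otimes> s) \<otimes> s"
        using c by (simp add: inv_mult_group m_assoc)
      then show ?thesis using c by simp
    qed
    ultimately show ?thesis by simp
  qed
  then have "\<Omega> \<times> S \<subseteq> arrows E" by blast
  then have gen: "\<Omega> \<times> carrier G \<subseteq> arrows E"
    using arrows_generate[OF Esub S(2)] S(3) by blast
  have "card E \<le> card E1 + card ((C \<union> B) \<times> K) + card (A \<times> S)"
    unfolding E_def by (meson add_le_mono card_Un_le le_refl le_trans)
  also have "\<dots> \<le> card \<Omega> + (card C + card B) * card K + card A * card S"
    using E1(3) card_mono[OF fin, of "\<Omega> - B"] card_Un_le[of C B]
    by (auto simp: card_cartesian_product intro!: add_mono mult_right_mono)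
  finally have "real (card E) \<le> real (card \<Omega> + (card C + card B) * card K + card A * card S)"
    by (rule of_nat_mono)
  also have "\<dots> = card \<Omega> + (real (card C) + card B) * card K + real (card A) * card S" by simp
  also have "\<dots> \<le> card \<Omega> + (\<eta> * card \<Omega> + \<delta> * card \<Omega>) * card K + (card \<Omega> / card M + \<delta> * card \<Omega>) * card S"
  proof -
    have "\<eta> * card (\<Omega> - B) \<le> \<eta> * card \<Omega>"
      using \<eta> fin by (intro mult_left_mono) (auto intro: card_mono)
    then have "real (card C) + card B \<le> \<eta> * card \<Omega> + \<delta> * card \<Omega>" using C(2) B(2) by linarith
    moreover have "real (card A) \<le> card \<Omega> / card M + \<delta> * card \<Omega>" using A(2) B(2) by linarith
    ultimately show ?thesis
      using mult_right_mono[of "real (card C) + card B" _ "real (card K)"]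
        mult_right_mono[of "real (card A)" _ "real (card S)"] by (simp add: add_mono)
  qed
  also have "\<dots> = (1 + (card K * (\<eta> + \<delta>) + card S * (1 / card M + \<delta>))) * card \<Omega>"
    by (simp add: algebra_simps)
  finally show ?thesis using Esub finE gen by blast
qed

end

section \<open>Fixed points on the levels of a Farber chain\<close>

context subgroup_chain
begin

text \<open>The rays fixed by \<open>g\<close> form the decreasing intersection of the clopen sets of rays whose
  level-\<open>n\<close> vertex is fixed by \<open>g\<close>. The measure of such a set is the fraction of fixed vertices, and
  the intersection is null by essential freeness.\<close>

lemma fixed_fraction_tendsto_0:
  assumes farber: "AE r in boundary_measure G H. ray_stabilizer G r = {\<one>}"
    and g: "g \<in> carrier G" "g \<noteq> \<one>"
  shows "(\<lambda>n. real (card {t \<in> V n. t #> g = t}) / real (card (V n))) \<longlonglongrightarrow> 0"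
proof -
  let ?M = "boundary_measure G H"
  have bm: "is_boundary_measure G H ?M" by (rule boundary_measure)
  then interpret M: prob_space ?M by (simp add: is_boundary_measure_def)
  have sp: "space ?M = Bd" using bm by (simp add: is_boundary_measure_def)
  have sh: "Sh n t \<in> sets ?M" "measure ?M (Sh n t) = 1 / real (card (V n))" if "t \<in> V n" for n t
  proof -
    show "measure ?M (Sh n t) = 1 / real (card (V n))"
      using bm that by (simp add: is_boundary_measure_def index_def level_vertices_def)
    have "sets ?M = sigma_sets Bd (shadows G H)"
      using bm by (simp add: is_boundary_measure_def borel_eq_sigma_shadows)
    then show "Sh n t \<in> sets ?M" using that by (auto simp: shadows_def)
  qed
  define F where "F n = {t \<in> V n. t #> g = t}" for n
  define A where "A n = {r \<in> Bd. r n #> g = r n}" for n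
  have A_UN: "A n = (\<Union>t\<in>F n. Sh n t)" for n
    by (auto simp: A_def F_def shadow_def Bd_iff)
  have finF: "finite (F n)" for n using finite_V by (simp add: F_def)
  have A_sets: "A n \<in> sets ?M" for n
    unfolding A_UN using finF sh by (intro sets.finite_UN) (auto simp: F_def)
  have A_measure: "measure ?M (A n) = real (card (F n)) / real (card (V n))" for n
  proof -
    have "measure ?M (A n) = (\<Sum>t\<in>F n. measure ?M (Sh n t))"
      unfolding A_UN
    proof (rule M.finite_measure_finite_Union[OF finF])
      show "Sh n ` F n \<subseteq> sets ?M" using sh by (auto simp: F_def)
      show "disjoint_family_on (Sh n) (F n)" by (auto simp: disjoint_family_on_def shadow_def)
    qed
    also have "\<dots> = (\<Sum>t\<in>F n. 1 / real (card (V n)))"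
      using sh by (intro sum.cong) (auto simp: F_def)
    finally show ?thesis by simp
  qed
  have "decseq A"
  proof (rule decseq_SucI, rule subsetI)
    fix n r assume r: "r \<in> A (Suc n)"
    then have Bd: "r \<in> Bd" and eq: "r (Suc n) #> g = r (Suc n)" by (auto simp: A_def)
    have V: "r n \<in> V n" "r (Suc n) \<in> V (Suc n)" "r (Suc n) \<subseteq> r n" using Bd by (auto simp: Bd_iff)
    obtain x where x: "x \<in> r (Suc n)" using V V_nonempty by blast
    have "x \<in> r n #> g" using r_coset_mono[OF V(3), of g] x eq by blast
    then have "r n #> g = r n" using V_eqI[OF V_translate[OF V(1) g(1)] V(1)] x V by blast
    then show "r \<in> A n" using Bd by (simp add: A_def)
  qed
  then have "(\<lambda>n. measure ?M (A n)) \<longlonglongrightarrow> measure ?M (\<Inter>n. A n)"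
    using A_sets by (intro M.finite_Lim_measure_decseq) auto
  moreover have "measure ?M (\<Inter>n. A n) = 0"
  proof -
    have "AE r in ?M. r \<notin> (\<Inter>n. A n)"
      using farber
    proof (eventually_elim)
      fix r assume "ray_stabilizer G r = {\<one>}"
      then have "ray_action G r g \<noteq> r" using g by (auto simp: ray_stabilizer_def)
      then show "r \<notin> (\<Inter>n. A n)" by (auto simp: A_def ray_action_def fun_eq_iff)
    qed
    moreover have "(\<Inter>n. A n) \<in> sets ?M" using A_sets by (intro sets.countable_INT) auto
    ultimately show ?thesis by (simp add: M.prob_eq_0)
  qed
  ultimately show ?thesis by (simp add: A_measure F_def)
qed

lemma few_fixed_vertices:
  assumes farber: "AE r in boundary_measure G H. ray_stabilizer G r = {\<one>}"
    and Q: "finite Q" "Q \<subseteq> carrier G - {\<one>}" and \<delta>: "0 < \<delta>"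
  shows "\<forall>\<^sub>F n in sequentially. real (card {t \<in> V n. \<exists>q\<in>Q. t #> q = t}) \<le> \<delta> * real (card (V n))"
proof -
  have pos: "0 < card (V n)" for n
    using finite_V H_in_V by (metis card_gt_0_iff empty_iff)
  have "(\<lambda>n. \<Sum>q\<in>Q. real (card {t \<in> V n. t #> q = t}) / real (card (V n))) \<longlonglongrightarrow> (\<Sum>q\<in>Q. 0)"
    using Q by (intro tendsto_sum fixed_fraction_tendsto_0[OF farber]) auto
  then have "\<forall>\<^sub>F n in sequentially.
      (\<Sum>q\<in>Q. real (card {t \<in> V n. t #> q = t}) / real (card (V n))) < \<delta>"
    using \<delta> by (auto dest: order_tendstoD)
  then show ?thesis
  proof eventually_elim
    case (elim n)
    have "{t \<in> V n. \<exists>q\<in>Q. t #> q = t} = (\<Union>q\<in>Q. {t \<in> V n. t #> q = t})" by auto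
    then have "real (card {t \<in> V n. \<exists>q\<in>Q. t #> q = t}) \<le> (\<Sum>q\<in>Q. real (card {t \<in> V n. t #> q = t}))"
      using card_UN_le[OF Q(1), of "\<lambda>q. {t \<in> V n. t #> q = t}"] by (simp flip: of_nat_sum)
    also have "\<dots> \<le> \<delta> * real (card (V n))"
      using elim pos[of n] by (simp add: sum_divide_distrib[symmetric] field_simps)
    finally show ?case .
  qed
qed

lemma index_pos: "0 < index G (H n)"
  using finite_V H_in_V by (metis card_gt_0_iff empty_iff index_def level_vertices_def)

lemma chain_infinite:
  assumes "infinite (carrier G)" shows "infinite (H n)"
proof
  assume f: "finite (H n)"
  have "carrier G = \<Union>(V n)"
    using rcosets_part_G[OF chain_subgroup] by (simp add: level_vertices_def)
  moreover have "finite t" if "t \<in> V n" for t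
    using that card_rcosets_equal[OF _ H_subset, of t n] f
    by (auto simp: level_vertices_def RCOSETS_def r_coset_def)
  ultimately show False using assms finite_V by auto
qed

section \<open>The rank gradient\<close>

lemma coset_action: "right_action G (V n) (r_coset G)"
proof
  fix t g h assume t: "t \<in> V n"
  show "t #> \<one> = t" using V_subset[OF t] by (rule coset_mult_one)
  show "g \<in> carrier G \<Longrightarrow> t #> g \<in> V n" using t by (rule V_translate)
  show "g \<in> carrier G \<Longrightarrow> h \<in> carrier G \<Longrightarrow> t #> (g \<otimes> h) = t #> g #> h"
    using V_subset[OF t] by (simp add: coset_mult_assoc)
qed

lemma stabilizer_H: "{g \<in> carrier G. H n #> g = H n} = H n"
proof (intro equalityI subsetI)
  fix g assume "g \<in> {g \<in> carrier G. H n #> g = H n}"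
  then show "g \<in> H n" using rcos_self[OF _ chain_subgroup, of g n] by auto
next
  fix g assume "g \<in> H n"
  then show "g \<in> {g \<in> carrier G. H n #> g = H n}"
    using coset_join2[OF _ chain_subgroup, of g n] H_subset by blast
qed

text \<open>The lower bound holds because the empty set only generates the trivial group.\<close>

lemma min_generators_bounds:
  assumes A: "finite A" "A \<subseteq> H n" "H n \<subseteq> generate G A" and inf: "infinite (H n)"
  shows "1 \<le> min_generators (G\<lparr>carrier := H n\<rparr>)" "min_generators (G\<lparr>carrier := H n\<rparr>) \<le> card A"
proof -
  let ?P = "\<lambda>k. \<exists>S. finite S \<and> card S = k \<and> S \<subseteq> H n \<and> generate G S = H n"
  have gen: "generate (G\<lparr>carrier := H n\<rparr>) S = generate G S" if "S \<subseteq> H n" for S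
    using generate_consistent[OF that chain_subgroup] .
  have mg: "min_generators (G\<lparr>carrier := H n\<rparr>) = (LEAST k. ?P k)"
    unfolding min_generators_def by (rule arg_cong[where f = Least]) (use gen in \<open>auto simp: fun_eq_iff\<close>)
  have "generate G A = H n" using generate_subgroup_incl[OF A(2) chain_subgroup] A(3) by blast
  then have P: "?P (card A)" using A by blast
  then show "min_generators (G\<lparr>carrier := H n\<rparr>) \<le> card A" unfolding mg by (rule Least_le)
  have "\<not> ?P 0"
  proof
    assume "?P 0"
    then have "generate G {} = H n" by auto
    moreover have "finite (generate G {})" by (simp add: generate_empty)
    ultimately show False using inf by simp
  qed
  moreover have "?P (min_generators (G\<lparr>carrier := H n\<rparr>))" unfolding mg using P by (rule LeastI)
  ultimately show "1 \<le> min_generators (G\<lparr>carrier := H n\<rparr>)" by (metis less_one linorder_not_less)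
qed

lemma rank_ratio_bounds:
  fixes \<epsilon> :: real
  assumes E: "E \<subseteq> V n \<times> carrier G" "finite E"
    and gen: "V n \<times> carrier G \<subseteq> right_action.arrows G (V n) (r_coset G) E"
    and few: "real (card E) \<le> (1 + \<epsilon>) * card (V n)"
    and inf: "infinite (H n)"
  shows "0 \<le> rank_ratio G H n" "rank_ratio G H n \<le> \<epsilon>"
proof -
  interpret act: right_action G "V n" "r_coset G" by (rule coset_action)
  have trans: "\<exists>g\<in>carrier G. H n #> g = t" if "t \<in> V n" for t using that by (auto simp: V_iff)
  have "\<exists>A. finite A \<and> card A + card (V n) \<le> card E + 1 \<and> A \<subseteq> {g \<in> carrier G. H n #> g = H n} \<and>
      {g \<in> carrier G. H n #> g = H n} \<subseteq> generate G A"
    by (rule act.stabilizer_generators[OF E finite_V H_in_V gen trans])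
  then obtain A where A: "finite A" "card A + card (V n) \<le> card E + 1" "A \<subseteq> H n" "H n \<subseteq> generate G A"
    unfolding stabilizer_H by (elim exE conjE) (rule that)
  note bounds = min_generators_bounds[OF A(1,3,4) inf]
  have idx: "index G (H n) = card (V n)" by (simp add: index_def level_vertices_def)
  show "0 \<le> rank_ratio G H n" using bounds(1) by (simp add: rank_ratio_def)
  have "real (min_generators (G\<lparr>carrier := H n\<rparr>)) - 1 \<le> \<epsilon> * card (V n)"
    using bounds(2) A(2) few by (simp add: algebra_simps)
  then show "rank_ratio G H n \<le> \<epsilon>"
    using index_pos[of n] by (simp add: rank_ratio_def idx pos_divide_le_eq)
qed

text \<open>All constants are chosen before the level \<open>n\<close>: first \<open>M\<close>, hence the density of the section, then the
  finite set \<open>K\<close> and the Folner set \<open>F\<close> for \<open>K\<close>, and last the finite set \<open>Q\<close> of nontrivial elements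
  whose fixed points obstruct freeness. For large \<open>n\<close> the points fixed by an element of \<open>Q\<close>
  are few.\<close>

lemma rank_ratio_eventually_small:
  fixes \<epsilon> :: real
  assumes fg: "finitely_generated G"
    and N: "N \<lhd> G" "infinite N" "amenable (G\<lparr>carrier := N\<rparr>)"
    and farber: "AE r in boundary_measure G H. ray_stabilizer G r = {\<one>}"
    and \<epsilon>: "0 < \<epsilon>"
  shows "\<forall>\<^sub>F n in sequentially. 0 \<le> rank_ratio G H n \<and> rank_ratio G H n \<le> \<epsilon>"
proof -
  interpret N: normal N G by (rule N(1))
  have subN: "subgroup N G" by (rule N.subgroup_axioms)
  obtain S where S: "finite S" "S \<subseteq> carrier G" "generate G S = carrier G"
    using fg by (auto simp: finitely_generated_def)
  obtain m :: nat where m: "4 * card S / \<epsilon> < m" using reals_Archimedean2 by blast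
  obtain M where M: "finite M" "card M = Suc m" "M \<subseteq> N"
    using infinite_arbitrarily_large[OF N(2)] by blast
  have Mc: "M \<subseteq> carrier G" "M \<noteq> {}" using M N.subset by auto
  define K where "K = (\<lambda>(a, b). a \<otimes> inv b) ` (M \<times> M) \<union>
    (\<lambda>(s, a, b). inv s \<otimes> (b \<otimes> inv a) \<otimes> s) ` (S \<times> M \<times> M)"
  have Kfin: "finite K" using M(1) S(1) by (simp add: K_def)
  have MK: "a \<otimes> inv b \<in> K" if "a \<in> M" "b \<in> M" for a b using that by (force simp: K_def)
  have conjK: "inv s \<otimes> (b \<otimes> inv a) \<otimes> s \<in> K" if "a \<in> M" "b \<in> M" "s \<in> S" for a b s
    using that by (force simp: K_def)
  have KN: "K \<subseteq> N"
  proof -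
    have 1: "a \<otimes> inv b \<in> N" if "a \<in> M" "b \<in> M" for a b using that M(3) by auto
    then have "inv s \<otimes> (b \<otimes> inv a) \<otimes> s \<in> N" if "a \<in> M" "b \<in> M" "s \<in> S" for a b s
      using that S(2) by (intro N.inv_op_closed1) auto
    then show ?thesis using 1 by (auto simp: K_def)
  qed
  have Kc: "K \<subseteq> carrier G" using KN N.subset by blast
  have Kinv: "inv k \<in> K" if k: "k \<in> K" for k
  proof -
    consider a b where "a \<in> M" "b \<in> M" "k = a \<otimes> inv b"
      | s a b where "s \<in> S" "a \<in> M" "b \<in> M" "k = inv s \<otimes> (b \<otimes> inv a) \<otimes> s"
      using k by (auto simp: K_def)
    then show ?thesis
    proof cases
      case 1
      then have "a \<in> carrier G" "b \<in> carrier G" using Mc by auto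
      then have "inv k = b \<otimes> inv a" using 1 by (simp add: inv_mult_group)
      then show ?thesis using MK 1 by simp
    next
      case 2
      then have "a \<in> carrier G" "b \<in> carrier G" "s \<in> carrier G" using Mc S by auto
      then have "inv k = inv s \<otimes> (a \<otimes> inv b) \<otimes> s" using 2 by (simp add: inv_mult_group m_assoc)
      then show ?thesis using conjK 2 by simp
    qed
  qed
  \<comment> \<open>the three error terms each get at most a quarter of \<open>\<epsilon>\<close>; the summands 1 avoid division by zero\<close>
  define \<eta> where "\<eta> = \<epsilon> / (4 * (card K + 1))"
  define \<delta> where "\<delta> = \<epsilon> / (4 * (card K + card S + 1))"
  have pos: "0 < \<eta>" "0 < \<delta>" using \<epsilon> by (simp_all add: \<eta>_def \<delta>_def)
  have "\<exists>F. finite F \<and> F \<noteq> {} \<and> F \<subseteq> N \<and> real (card {f \<in> F. \<exists>k\<in>K. f \<otimes> k \<notin> F}) \<le> \<eta> * card F"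
    using group.amenable_Folner[OF subgroup_imp_group[OF subN] N(3) Kfin _ pos(1)] KN by simp
  then obtain F where F: "finite F" "F \<noteq> {}" "F \<subseteq> N"
    and Folner: "real (card {f \<in> F. \<exists>k\<in>K. f \<otimes> k \<notin> F}) \<le> \<eta> * card F"
    by blast
  have Fc: "F \<subseteq> carrier G" using F(3) N.subset by blast
  \<comment> \<open>the conjugates of \<open>a \<otimes> inv b\<close> by \<open>f\<close> fix \<open>t #> f\<close> when \<open>a\<close> and \<open>b\<close> move \<open>t\<close> to the same
    point; \<open>f = \<one>\<close> is included because \<open>M\<close> must be free at the point itself\<close>
  define Q where "Q = (\<lambda>(f, a, b). inv f \<otimes> (a \<otimes> inv b) \<otimes> f) ` (insert \<one> F \<times> (M \<union> F) \<times> (M \<union> F)) - {\<one>}"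
  have Q: "finite Q" "Q \<subseteq> carrier G - {\<one>}" using F(1) M(1) Fc Mc by (auto simp: Q_def subset_iff)
  have "infinite (carrier G)" using N(2) N.subset finite_subset by blast
  note inf = chain_infinite[OF this]
  have small: "card K * (\<eta> + \<delta>) + card S * (1 / card M + \<delta>) \<le> \<epsilon>"
  proof -
    have "card K * \<eta> \<le> \<epsilon> / 4" using \<epsilon> by (simp add: \<eta>_def field_simps)
    moreover have "(real (card K) + card S) * \<delta> \<le> \<epsilon> / 4" using \<epsilon> by (simp add: \<delta>_def field_simps)
    moreover have "card S * (1 / card M) \<le> \<epsilon> / 4"
    proof -
      have "4 * card S < \<epsilon> * m" using m \<epsilon> by (simp add: field_simps)
      also have "\<dots> \<le> \<epsilon> * card M" using \<epsilon> M(2) by simp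
      finally show ?thesis using M(2) by (simp add: field_simps)
    qed
    moreover have "card K * (\<eta> + \<delta>) + card S * (1 / card M + \<delta>)
        = card K * \<eta> + (real (card K) + card S) * \<delta> + card S * (1 / card M)"
      by (simp add: algebra_simps)
    ultimately show ?thesis using \<epsilon> by linarith
  qed
  show ?thesis
    using few_fixed_vertices[OF farber Q pos(2)]
  proof eventually_elim
    case (elim n)
    interpret act: right_action G "V n" "r_coset G" by (rule coset_action)
    define B where "B = {t \<in> V n. \<exists>q\<in>Q. t #> q = t}"
    have B: "B \<subseteq> V n" "real (card B) \<le> \<delta> * card (V n)" using elim by (auto simp: B_def)
    have free: "a = b"
      if t: "t \<in> V n" and f: "f \<in> insert \<one> F" and tf: "t #> f \<in> V n - B"
        and ab: "a \<in> M \<union> F" "b \<in> M \<union> F" "t #> a = t #> b" for t f a b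
    proof -
      have c: "f \<in> carrier G" "a \<in> carrier G" "b \<in> carrier G" using f ab Mc Fc by auto
      let ?q = "inv f \<otimes> (a \<otimes> inv b) \<otimes> f"
      have "t #> f #> ?q = t #> f" by (rule act.conjugate_fixes[OF t c ab(3)])
      then have "?q \<notin> Q" using tf unfolding B_def by blast
      moreover have "?q \<in> (\<lambda>(f, a, b). inv f \<otimes> (a \<otimes> inv b) \<otimes> f) ` (insert \<one> F \<times> (M \<union> F) \<times> (M \<union> F))"
        by (rule image_eqI[where x = "(f, a, b)"]) (use f ab in auto)
      ultimately have "?q = \<one>" unfolding Q_def by blast
      then show ?thesis by (rule conjugate_eq_one[OF c])
    qed
    have freeM: "a = b" if "t \<in> V n - B" "a \<in> M" "b \<in> M" "t #> a = t #> b" for t a b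
    proof -
      have "t #> \<one> = t" using that by (intro act.act_one) auto
      then show ?thesis using free[of t \<one> a b] that by simp
    qed
    have freeF: "a = b"
      if "t \<in> V n" "f \<in> F" "t #> f \<in> V n - B" "a \<in> F" "b \<in> F" "t #> a = t #> b" for t f a b
      using free[of t f a b] that by blast
    have "\<exists>E. E \<subseteq> V n \<times> carrier G \<and> finite E \<and> V n \<times> carrier G \<subseteq> act.arrows E \<and>
        real (card E) \<le> (1 + (card K * (\<eta> + \<delta>) + card S * (1 / card M + \<delta>))) * card (V n)"
      by (rule act.cheap_generating_arrows[OF finite_V S M(1) Mc(2,1) Kfin Kc Kinv MK conjK F(1,2) Fc
            Folner less_imp_le[OF pos(1)] B freeM freeF])
    then obtain E where E: "E \<subseteq> V n \<times> carrier G" "finite E" "V n \<times> carrier G \<subseteq> act.arrows E"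
        "real (card E) \<le> (1 + (card K * (\<eta> + \<delta>) + card S * (1 / card M + \<delta>))) * card (V n)"
      by (elim exE conjE) (rule that)
    note bounds = rank_ratio_bounds[OF E inf]
    show ?case using bounds small by linarith
  qed
qed

end

theorem theorem3:
  fixes G :: "('a, 'b) monoid_scheme" and H :: "nat \<Rightarrow> 'a set"
  assumes "group G"
    and "finitely_generated G"
    and "residually_finite G"
    and "\<exists>N. N \<lhd> G \<and> infinite N \<and> amenable (G\<lparr>carrier := N\<rparr>)"
    and "farber_chain G H"
  shows "convergent (rank_ratio G H) \<and> rank_gradient G H = 0"
proof -
  interpret subgroup_chain G H using assms(5) by (simp add: farber_chain_def)
  have farber: "AE r in boundary_measure G H. ray_stabilizer G r = {\<one>\<^bsub>G\<^esub>}"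
    using assms(5) by (simp add: farber_chain_def)
  obtain N where N: "N \<lhd> G" "infinite N" "amenable (G\<lparr>carrier := N\<rparr>)" using assms(4) by blast
  have "rank_ratio G H \<longlonglongrightarrow> 0"
  proof (rule tendstoI)
    fix \<epsilon> :: real assume "0 < \<epsilon>"
    then have "\<forall>\<^sub>F n in sequentially. 0 \<le> rank_ratio G H n \<and> rank_ratio G H n \<le> \<epsilon> / 2"
      by (intro rank_ratio_eventually_small[OF assms(2) N farber]) simp
    then show "\<forall>\<^sub>F n in sequentially. dist (rank_ratio G H n) 0 < \<epsilon>"
      by eventually_elim (use \<open>0 < \<epsilon>\<close> in auto)
  qed
  then show ?thesis by (auto simp: rank_gradient_def intro: convergentI limI)
qed

end
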